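(* There exist absolute constants $A>0$ and $B>0$ such that for all $\varepsilon\in(0,1)$, the $\ell_2$-mixing time $t_{\mathsf{mix}}^{(2)}(\varepsilon)$ of the Markov chain on $\Omega=\mathrm{SL}_n(\mathbb{Z}_2)$ with transition matrix $P$ (the random walk generated by elementary transvections) satisfies \[ t_{\mathsf{mix}}^{(2)}(\varepsilon)\;\leq\; A\,n^2\log n + B\,n\log\left(\frac{1}{\varepsilon}\right). \]
   Context: Let $\mathbb{Z}_2$ be the field with two elements and let $\Omega=\mathrm{SL}_n(\mathbb{Z}_2)$ be the set of invertible $n\times n$ matrices with entries in $\mathbb{Z}_2$. Let $I$ be the $n\times n$ identity matrix and, for $1\leq i\neq j\leq n$, let $E_{i,j}$ be the $n\times n$ matrix with a $1$ in position $(i,j)$ and $0$ elsewhere. The transition matrix $P$ on $\Omega$ is defined by \[ P(x,y)=\begin{cases}\frac{1}{n(n-1)} & \text{if } y=(I+E_{i,j})x \text{ for some } 1\leq i\neq j\leq n,\\ 0 & \text{otherwise.}\end{cases} \] That is, at each step an ordered pair of distinct rows is picked uniformly at random and one is added to the other modulo $2$. The matrix $P$ is symmetric and the uniform distribution $\pi$ on $\Omega$ is its unique stationary distribution. $P^t$ denotes the $t$-step transition matrix. For $f\colon\Omega\to\mathbb{R}$, let $\|f\|_{2,\pi}=\left(\sum_{x\in\Omega}\pi(x)f(x)^2\right)^{1/2}$. For $\varepsilon\in(0,1)$, the $\ell_2$-mixing time is \[ t_{\mathsf{mix}}^{(2)}(\varepsilon)=\min\left\{t\geq 0:\ \max_{x\in\Omega}\left\|\frac{P^t(x,\cdot)}{\pi(\cdot)}-1\right\|_{2,\pi}\leq\varepsilon\right\},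 \] where $t$ ranges over integers. "Absolute constants" means constants that do not depend on $n$ or $\varepsilon$.
   Formalization: The formal statement assumes n ≥ 3: for n = 1 the matrix P is undefined (1/(n(n−1)) = 1/0), and for n = 2 the walk on SL_2(Z_2) ≅ S_3 has period 2, so the ℓ_2-distance never drops below 1 and the mixing time is infinite. *)

theory Defs
  imports
    Complex_Main
    "HOL-Library.Z2"
    "HOL-Library.Extended_Real"
    "Jordan_Normal_Form.Matrix"
begin

text \<open>A transition matrix on a finite state space \<open>S\<close> is a function \<open>P x y\<close>, of which only
  the values at \<open>x, y \<in> S\<close> matter.\<close>

primrec step_matrix :: "'s set \<Rightarrow> ('s \<Rightarrow> 's \<Rightarrow> real) \<Rightarrow> nat \<Rightarrow> 's \<Rightarrow> 's \<Rightarrow> real" where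
  "step_matrix S P 0 = (\<lambda>x y. if x = y then 1 else 0)"
| "step_matrix S P (Suc t) = (\<lambda>x y. \<Sum>z\<in>S. step_matrix S P t x z * P z y)"

definition l2_norm :: "'s set \<Rightarrow> ('s \<Rightarrow> real) \<Rightarrow> ('s \<Rightarrow> real) \<Rightarrow> real" where
  "l2_norm S \<pi> f = sqrt (\<Sum>x\<in>S. \<pi> x * (f x)\<^sup>2)"

definition l2_dist :: "'s set \<Rightarrow> ('s \<Rightarrow> 's \<Rightarrow> real) \<Rightarrow> ('s \<Rightarrow> real) \<Rightarrow> nat \<Rightarrow> real" where
  "l2_dist S P \<pi> t = Max ((\<lambda>x. l2_norm S \<pi> (\<lambda>y. step_matrix S P t x y / \<pi> y - 1)) ` S)"

text \<open>The minimum is taken in \<open>enat\<close>, so that it is \<open>\<infinity>\<close>, and not an unspecified number, if the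
  chain never comes within distance \<open>\<epsilon>\<close> of \<open>\<pi>\<close>.\<close>

definition l2_mixing_time ::
    "'s set \<Rightarrow> ('s \<Rightarrow> 's \<Rightarrow> real) \<Rightarrow> ('s \<Rightarrow> real) \<Rightarrow> real \<Rightarrow> enat" where
  "l2_mixing_time S P \<pi> \<epsilon> = (INF t \<in> {t. l2_dist S P \<pi> t \<le> \<epsilon>}. enat t)"

text \<open>Over the two-element field \<^typ>\<open>bit\<close> every invertible matrix has determinant 1. Rows and
  columns are indexed by \<open>0, \<dots>, n - 1\<close>.\<close>

definition SL :: "nat \<Rightarrow> bit mat set" where
  "SL n = {x \<in> carrier_mat n n. invertible_mat x}"

definition E :: "nat \<Rightarrow> nat \<Rightarrow> nat \<Rightarrow> bit mat" where
  "E n i j = mat n n (\<lambda>(k, l). if k = i \<and> l = j then 1 else 0)"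

text \<open>For \<open>n = 2\<close> this walk has period 2, since \<open>SL 2\<close> is the symmetric group on three points and both
  generators are transpositions; its mixing time is then \<open>\<infinity>\<close> for every \<open>\<epsilon> < 1\<close>.\<close>

definition transvection_walk :: "nat \<Rightarrow> bit mat \<Rightarrow> bit mat \<Rightarrow> real" where
  "transvection_walk n x y =
    (if \<exists>i<n. \<exists>j<n. i \<noteq> j \<and> y = (1\<^sub>m n + E n i j) * x
     then 1 / (real n * (real n - 1)) else 0)"

definition uniform :: "'s set \<Rightarrow> 's \<Rightarrow> real" where
  "uniform S x = 1 / real (card S)"

end

theory Submission
  imports Defs "HOL-Analysis.Function_Topology" "HOL-Analysis.Convex"
begin

text \<open>Let \<open>N = n (n - 1)\<close> and let \<open>D = N (1 - P)\<close> be the sum of \<open>1 - s\<close> over all elementary transvections \<open>s\<close>.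
  By transitivity the squared \<open>\<ell>\<^sub>2\<close> distance at time \<open>t\<close> is the sum of \<open>(1 - \<lambda> / N) ^ (2 t)\<close> over the
  nonzero eigenvalues \<open>\<lambda>\<close> of \<open>D\<close>, and three facts bound it.

  (1) Spectral gap of order \<open>n\<close>: expand \<open>D\<^sup>2\<close> into products \<open>(1 - s) (1 - s')\<close>. Commuting pairs
  contribute nonnegative terms, opposite pairs are absorbed by the squares, and the pairs inside a
  Heisenberg group (dihedral of order 8) sum up to a positive multiple of \<open>1 - c\<close>, where \<open>c\<close> is
  the central transvection. Hence \<open>D\<^sup>2 \<ge> (n - 2) / 6 D\<close>.

  (2) The commutator relation is a relation of odd length 5, which bounds \<open>\<lambda>\<close> away from \<open>2 N\<close>.

  (3) The trace of \<open>exp (- r D)\<close> at \<open>r = ln n / 2\<close> is at most \<open>exp (2 n)\<close>. By the Golden-Thompson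
  inequality the return probability of a sum of two generators is at most the product of the two
  return probabilities when the groups they generate meet trivially. Adding transvections one at a
  time inside the upper and the lower unitriangular group, and combining the two, gives the same bound
  \<open>((1 + exp (- 2 r)) / 2) ^ N\<close> as for \<open>N\<close> independent bits.

  Time of order \<open>n\<^sup>2 ln n\<close> thus reduces the trace from \<open>2 ^ (n\<^sup>2)\<close> to \<open>exp (O(n))\<close>, and by (1) a time of
  order \<open>n (n + ln (1 / \<epsilon>))\<close> suffices for the rest.\<close>

section \<open>Kernels on a finite set\<close>

locale finite_index =
  fixes S :: "'a set"
  assumes finite_S [simp]: "finite S"
begin

definition mm :: "('a \<Rightarrow> 'a \<Rightarrow> real) \<Rightarrow> ('a \<Rightarrow> 'a \<Rightarrow> real) \<Rightarrow> 'a \<Rightarrow> 'a \<Rightarrow> real" where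
  "mm K L = (\<lambda>x y. \<Sum>z\<in>S. K x z * L z y)"

definition tp :: "('a \<Rightarrow> 'a \<Rightarrow> real) \<Rightarrow> 'a \<Rightarrow> 'a \<Rightarrow> real" where
  "tp K = (\<lambda>x y. K y x)"

definition tr :: "('a \<Rightarrow> 'a \<Rightarrow> real) \<Rightarrow> real" where
  "tr K = (\<Sum>x\<in>S. K x x)"

definition one :: "'a \<Rightarrow> 'a \<Rightarrow> real" where
  "one = (\<lambda>x y. if x = y then 1 else 0)"

text \<open>\<open>pp K m\<close> is the power \<open>K ^ (2 ^ m)\<close>. Since its exponent is never 0, no unit is needed, and the
  algebra holds for all kernels, whatever their values off \<open>S \<times> S\<close>.\<close>

primrec pp :: "('a \<Rightarrow> 'a \<Rightarrow> real) \<Rightarrow> nat \<Rightarrow> 'a \<Rightarrow> 'a \<Rightarrow> real" where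
  "pp K 0 = K"
| "pp K (Suc m) = mm (pp K m) (pp K m)"

lemma mm_assoc: "mm (mm K L) M = mm K (mm L M)"
proof (intro ext)
  fix x y
  have "mm (mm K L) M x y = (\<Sum>z\<in>S. \<Sum>w\<in>S. K x w * L w z * M z y)"
    by (simp add: mm_def sum_distrib_right)
  also have "\<dots> = (\<Sum>w\<in>S. \<Sum>z\<in>S. K x w * L w z * M z y)"
    by (rule sum.swap)
  also have "\<dots> = mm K (mm L M) x y"
    by (simp add: mm_def sum_distrib_left mult.assoc)
  finally show "mm (mm K L) M x y = mm K (mm L M) x y" .
qed

lemma tr_mm: "tr (mm K L) = tr (mm L K)"
  unfolding tr_def mm_def by (subst sum.swap) (simp add: mult.commute)

lemma tp_tp [simp]: "tp (tp K) = K"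
  by (simp add: tp_def)

lemma tp_mm: "tp (mm K L) = mm (tp L) (tp K)"
  by (simp add: tp_def mm_def mult.commute)

lemma tp_pp: "tp (pp K m) = pp (tp K) m"
  by (induction m) (simp_all add: tp_mm)

lemma pp_square: "pp (mm K K) m = pp K (Suc m)"
  by (induction m) simp_all

text \<open>Since (K L)^2 = K (L K L), the induction hypothesis, taken for arbitrary factors, moves
  \<open>K\<close> behind \<open>mm L (mm K L)\<close>, which leaves (L K)^2.\<close>

lemma tr_pp_mm: "tr (pp (mm K L) m) = tr (pp (mm L K) m)"
proof (induction m arbitrary: K L)
  case 0
  then show ?case by (simp add: tr_mm)
next
  case (Suc m)
  have "tr (pp (mm K L) (Suc m)) = tr (pp (mm K (mm L (mm K L))) m)"
    by (simp only: pp_square [symmetric] mm_assoc)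
  also have "\<dots> = tr (pp (mm (mm L (mm K L)) K) m)"
    by (rule Suc)
  also have "\<dots> = tr (pp (mm L K) (Suc m))"
    by (simp only: pp_square [symmetric] mm_assoc)
  finally show ?case .
qed

section \<open>Trace inequalities for powers of products\<close>

lemma tr_mm_tp_nonneg: "tr (mm K (tp K)) \<ge> 0"
  by (simp add: tr_def mm_def tp_def sum_nonneg)

text \<open>The factors on the right are squared Hilbert-Schmidt norms and the trace on the left is
  the matching inner product, a sum over \<open>S \<times> S\<close>.\<close>

lemma trace_Cauchy_Schwarz: "(tr (mm K L))\<^sup>2 \<le> tr (mm K (tp K)) * tr (mm (tp L) L)"
proof -
  have "(\<Sum>p\<in>S \<times> S. K (fst p) (snd p) * L (snd p) (fst p))\<^sup>2
    \<le> (\<Sum>p\<in>S \<times> S. (K (fst p) (snd p))\<^sup>2) * (\<Sum>p\<in>S \<times> S. (L (snd p) (fst p))\<^sup>2)"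
    by (rule Cauchy_Schwarz_ineq_sum)
  then show ?thesis
    by (simp add: tr_def mm_def tp_def sum.cartesian_product split_def power2_eq_square)
qed

text \<open>With \<open>Z = X Y\<close> the first part reduces the second one to \<open>X\<^sup>2\<close> and \<open>Y\<^sup>2\<close>; the second part, for the
  Gram matrices of \<open>Z\<close> and its transpose, gives the first one for the next exponent.\<close>

lemma trace_power_le_aux:
  "(\<forall>Z. \<bar>tr (pp Z (Suc m))\<bar> \<le> tr (pp (mm Z (tp Z)) m)) \<and>
   (\<forall>X Y. tp X = X \<longrightarrow> tp Y = Y \<longrightarrow> tr (pp (mm X Y) m) \<le> tr (mm (pp X m) (pp Y m)))"
proof (induction m)
  case 0
  have "\<bar>tr (mm Z Z)\<bar> \<le> tr (mm Z (tp Z))" for Z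
  proof -
    have "(tr (mm Z Z))\<^sup>2 \<le> (tr (mm Z (tp Z)))\<^sup>2"
      using trace_Cauchy_Schwarz [of Z Z] tr_mm [of Z "tp Z"] by (simp add: power2_eq_square)
    then show ?thesis
      using tr_mm_tp_nonneg [of Z] by (metis abs_le_square_iff abs_of_nonneg)
  qed
  then show ?case by simp
next
  case (Suc m)
  have D: "\<bar>tr (pp Z (Suc m))\<bar> \<le> tr (pp (mm Z (tp Z)) m)" for Z
    using Suc by blast
  have C: "tr (pp (mm X Y) m) \<le> tr (mm (pp X m) (pp Y m))" if "tp X = X" "tp Y = Y" for X Y
    using Suc that by blast
  have 1: "\<bar>tr (pp Z (Suc (Suc m)))\<bar> \<le> tr (pp (mm Z (tp Z)) (Suc m))" for Z
  proof -
    \<comment> \<open>Cyclicity of the trace turns (Z Z) (Z Z)^T into the product of these two Gram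
      matrices.\<close>
    let ?A = "mm (tp Z) Z" and ?B = "mm Z (tp Z)"
    have sA: "tp ?A = ?A" and sB: "tp ?B = ?B" by (simp_all add: tp_mm)
    have "\<bar>tr (pp Z (Suc (Suc m)))\<bar> = \<bar>tr (pp (mm Z Z) (Suc m))\<bar>"
      by (simp only: pp_square)
    also have "\<dots> \<le> tr (pp (mm (mm Z Z) (tp (mm Z Z))) m)"
      by (rule D)
    also have "\<dots> = tr (pp (mm (mm Z (mm Z (tp Z))) (tp Z)) m)"
      by (simp only: tp_mm mm_assoc)
    also have "\<dots> = tr (pp (mm (tp Z) (mm Z (mm Z (tp Z)))) m)"
      by (rule tr_pp_mm)
    also have "\<dots> = tr (pp (mm ?A ?B) m)"
      by (simp only: mm_assoc)
    also have "\<dots> \<le> tr (mm (pp ?A m) (pp ?B m))"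
      by (rule C [OF sA sB])
    also have "\<dots> \<le> tr (pp ?B (Suc m))"
    proof -
      \<comment> \<open>By cyclicity the two Gram matrices have powers of equal trace, so both
        factors of the Cauchy-Schwarz bound coincide and the square can be removed.\<close>
      have eq: "tr (pp ?A (Suc m)) = tr (pp ?B (Suc m))"
        by (rule tr_pp_mm)
      have nn: "tr (pp ?B (Suc m)) \<ge> 0"
        using tr_mm_tp_nonneg [of "pp ?B m"] by (simp add: tp_pp sB)
      have "(tr (mm (pp ?A m) (pp ?B m)))\<^sup>2 \<le> tr (pp ?A (Suc m)) * tr (pp ?B (Suc m))"
        using trace_Cauchy_Schwarz [of "pp ?A m" "pp ?B m"] by (simp add: tp_pp sA sB)
      then have "(tr (mm (pp ?A m) (pp ?B m)))\<^sup>2 \<le> (tr (pp ?B (Suc m)))\<^sup>2"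
        by (simp only: eq power2_eq_square)
      then show ?thesis using nn power2_le_imp_le by blast
    qed
    finally show ?thesis .
  qed
  have 2: "tr (pp (mm X Y) (Suc m)) \<le> tr (mm (pp X (Suc m)) (pp Y (Suc m)))"
    if s: "tp X = X" "tp Y = Y" for X Y
  proof -
    have "tr (pp (mm X Y) (Suc m)) \<le> tr (pp (mm (mm X Y) (tp (mm X Y))) m)"
      using D [of "mm X Y"] by linarith
    also have "\<dots> = tr (pp (mm (mm X (mm Y Y)) X) m)"
      by (simp only: tp_mm s mm_assoc)
    also have "\<dots> = tr (pp (mm X (mm X (mm Y Y))) m)"
      by (rule tr_pp_mm)
    also have "\<dots> = tr (pp (mm (mm X X) (mm Y Y)) m)"
      by (simp only: mm_assoc)
    also have "\<dots> \<le> tr (mm (pp (mm X X) m) (pp (mm Y Y) m))"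
      by (rule C) (simp_all add: tp_mm s)
    finally show ?thesis by (simp only: pp_square)
  qed
  show ?case using 1 2 by blast
qed

text \<open>This is the Golden-Thompson inequality before the limit: \<open>X\<close> and
  \<open>Y\<close> will be Euler steps of two generators, and \<open>m\<close> tends to
  infinity.\<close>

lemma trace_power_product_le:
  assumes "tp X = X" "tp Y = Y"
  shows "tr (pp (mm X Y) m) \<le> tr (mm (pp X m) (pp Y m))"
  using trace_power_le_aux assms by blast

subsection \<open>Row sum norms\<close>

text \<open>The operator norm induced by the maximum norm is at most \<open>c\<close>. A relation
  avoids the maximum over \<open>S\<close>, which may be empty. The norm serves to control the error
  of the Trotter product.\<close>

definition bnd :: "('a \<Rightarrow> 'a \<Rightarrow> real) \<Rightarrow> real \<Rightarrow> bool" where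
  "bnd K c \<longleftrightarrow> (\<forall>x\<in>S. (\<Sum>y\<in>S. \<bar>K x y\<bar>) \<le> c)"

lemma bnd_mm:
  assumes "bnd K c" "bnd L d" "0 \<le> d"
  shows "bnd (mm K L) (c * d)"
  unfolding bnd_def
proof
  fix x assume x: "x \<in> S"
  have "(\<Sum>y\<in>S. \<bar>mm K L x y\<bar>) \<le> (\<Sum>y\<in>S. \<Sum>z\<in>S. \<bar>K x z\<bar> * \<bar>L z y\<bar>)"
    unfolding mm_def by (intro sum_mono order_trans [OF sum_abs]) (simp add: abs_mult)
  also have "\<dots> = (\<Sum>z\<in>S. \<bar>K x z\<bar> * (\<Sum>y\<in>S. \<bar>L z y\<bar>))"
    by (subst sum.swap) (simp add: sum_distrib_left)
  also have "\<dots> \<le> (\<Sum>z\<in>S. \<bar>K x z\<bar> * d)"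
    using assms(2) by (intro sum_mono mult_left_mono) (auto simp: bnd_def)
  also have "\<dots> \<le> c * d"
    using assms(1,3) x by (simp add: sum_distrib_right [symmetric] bnd_def mult_right_mono)
  finally show "(\<Sum>y\<in>S. \<bar>mm K L x y\<bar>) \<le> c * d" .
qed

lemma bnd_add:
  assumes "bnd K c" "bnd L d"
  shows "bnd (\<lambda>x y. K x y + L x y) (c + d)"
  unfolding bnd_def
proof
  fix x assume x: "x \<in> S"
  have "(\<Sum>y\<in>S. \<bar>K x y + L x y\<bar>) \<le> (\<Sum>y\<in>S. \<bar>K x y\<bar> + \<bar>L x y\<bar>)"
    by (intro sum_mono) simp
  also have "\<dots> \<le> c + d"
    using assms x by (simp add: bnd_def sum.distrib add_mono)
  finally show "(\<Sum>y\<in>S. \<bar>K x y + L x y\<bar>) \<le> c + d" .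
qed

lemma bnd_scale: "bnd K c \<Longrightarrow> bnd (\<lambda>x y. a * K x y) (\<bar>a\<bar> * c)"
  by (simp add: bnd_def abs_mult sum_distrib_left [symmetric] mult_left_mono)

lemma bnd_one: "bnd one 1"
  by (simp add: bnd_def one_def if_distrib cong: if_cong)

lemma bnd_mono: "bnd K c \<Longrightarrow> c \<le> d \<Longrightarrow> bnd K d"
  by (force simp: bnd_def)

lemma bnd_cong: "(\<And>x y. x \<in> S \<Longrightarrow> y \<in> S \<Longrightarrow> K x y = L x y) \<Longrightarrow> bnd K c \<Longrightarrow> bnd L c"
  by (simp add: bnd_def)

lemma ex_bnd: "\<exists>c\<ge>0. bnd K c"
proof (intro exI conjI)
  show "0 \<le> (\<Sum>x\<in>S. \<Sum>y\<in>S. \<bar>K x y\<bar>)"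
    by (intro sum_nonneg) auto
  show "bnd K (\<Sum>x\<in>S. \<Sum>y\<in>S. \<bar>K x y\<bar>)"
    unfolding bnd_def
    by (intro ballI member_le_sum) (auto intro: sum_nonneg)
qed

lemma bnd_pp: "bnd K c \<Longrightarrow> 0 \<le> c \<Longrightarrow> bnd (pp K m) (c ^ (2 ^ m))"
proof (induction m)
  case (Suc m)
  then show ?case using bnd_mm [of "pp K m" "c ^ 2 ^ m" "pp K m" "c ^ 2 ^ m"]
    by (simp add: power_add [symmetric] mult_2)
qed simp

text \<open>Telescoping: X^2 - Y^2 = X (X - Y) + (X - Y) Y. Each squaring thus doubles the error and
  multiplies it by the norm bound of the current powers.\<close>

lemma bnd_pp_diff:
  assumes X: "bnd X c" and Y: "bnd Y c" and c: "c \<ge> 1"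
    and d: "bnd (\<lambda>x y. X x y - Y x y) d" "d \<ge> 0"
  shows "bnd (\<lambda>x y. pp X m x y - pp Y m x y) (2 ^ m * c ^ (2 ^ m) * d)"
proof (induction m)
  case 0
  have "d \<le> c * d" using mult_right_mono [OF c d(2)] by simp
  then show ?case using d bnd_mono by auto
next
  case (Suc m)
  let ?X = "pp X m" and ?Y = "pp Y m" and ?c = "c ^ 2 ^ m"
  let ?D = "\<lambda>x y. ?X x y - ?Y x y"
  have c0: "0 \<le> ?c" using c by simp
  have bX: "bnd ?X ?c" and bY: "bnd ?Y ?c" using bnd_pp X Y c by auto
  have e0: "0 \<le> 2 ^ m * ?c * d" using c0 d by simp
  have 1: "bnd (mm ?X ?D) (?c * (2 ^ m * ?c * d))"
    by (rule bnd_mm [OF bX Suc e0])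
  have 2: "bnd (mm ?D ?Y) ((2 ^ m * ?c * d) * ?c)"
    by (rule bnd_mm [OF Suc bY c0])
  have eq: "?c * (2 ^ m * ?c * d) + (2 ^ m * ?c * d) * ?c = 2 ^ Suc m * c ^ (2 ^ Suc m) * d"
  proof -
    have "c ^ (2 ^ Suc m) = ?c * ?c"
      by (simp only: power_add [symmetric]) (simp add: mult_2)
    then show ?thesis by simp
  qed
  have "(\<lambda>x y. mm ?X ?D x y + mm ?D ?Y x y) = (\<lambda>x y. pp X (Suc m) x y - pp Y (Suc m) x y)"
    by (simp add: mm_def right_diff_distrib left_diff_distrib sum_subtractf)
  then show ?case
    using bnd_add [OF 1 2] by (simp only: eq)
qed

lemma abs_tr_le: "bnd K c \<Longrightarrow> \<bar>tr K\<bar> \<le> real (card S) * c"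
proof -
  assume K: "bnd K c"
  have "\<bar>tr K\<bar> \<le> (\<Sum>x\<in>S. \<bar>K x x\<bar>)"
    unfolding tr_def by (rule sum_abs)
  also have "\<dots> \<le> (\<Sum>x\<in>S. c)"
  proof (rule sum_mono)
    fix x assume x: "x \<in> S"
    then have "\<bar>K x x\<bar> \<le> (\<Sum>y\<in>S. \<bar>K x y\<bar>)"
      by (intro member_le_sum) auto
    also have "\<dots> \<le> c" using K x by (simp add: bnd_def)
    finally show "\<bar>K x x\<bar> \<le> c" .
  qed
  finally show ?thesis by simp
qed

text \<open>With \<open>k = 2 ^ m\<close>, \<open>pp (euler A m) m\<close> is Euler's approximation \<open>(1 + A / k) ^ k\<close> of the exponential.\<close>

definition euler :: "('a \<Rightarrow> 'a \<Rightarrow> real) \<Rightarrow> nat \<Rightarrow> 'a \<Rightarrow> 'a \<Rightarrow> real" where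
  "euler A m = (\<lambda>x y. one x y + A x y / 2 ^ m)"

lemma bnd_euler:
  assumes "bnd A c" "0 \<le> c"
  shows "bnd (euler A m) (exp (c / 2 ^ m))"
proof -
  have "bnd (euler A m) (1 + \<bar>1 / 2 ^ m\<bar> * c)"
    unfolding euler_def using bnd_add [OF bnd_one bnd_scale [OF assms(1), of "1 / 2 ^ m"]] by simp
  then show ?thesis
    using exp_ge_add_one_self [of "c / 2 ^ m"] by (auto elim: bnd_mono)
qed

text \<open>With k = 2 ^ m, one Euler step of the product differs from one step of the sum by A B /
  k^2. Taking the k-th power multiplies this by at most k exp (a + b), so an error of order 1 / k
  remains.\<close>

lemma Trotter_error:
  assumes A: "bnd A a" "0 \<le> a" and B: "bnd B b" "0 \<le> b"
  shows "bnd (\<lambda>x y. pp (mm (euler A m) (euler B m)) m x y - pp (euler (\<lambda>x y. A x y + B x y) m) m x y)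
           (exp (a + b) * (a * b) / 2 ^ m)"
proof -
  let ?X = "mm (euler A m) (euler B m)" and ?Y = "euler (\<lambda>x y. A x y + B x y) m"
  let ?c = "exp ((a + b) / 2 ^ m)"
  have 1: "bnd ?X ?c"
    using bnd_mm [OF bnd_euler [OF A, of m] bnd_euler [OF B, of m]]
    by (simp add: exp_add [symmetric] add_divide_distrib)
  have 2: "bnd ?Y ?c"
    using bnd_euler [OF bnd_add [OF A(1) B(1)]] A B by simp
  \<comment> \<open>The identity and the linear terms cancel, which leaves exactly the product of
    \<open>A\<close> and \<open>B\<close> divided by 4 ^ m.\<close>
  have 3: "bnd (\<lambda>x y. ?X x y - ?Y x y) (a * b / 4 ^ m)"
  proof (rule bnd_cong)
    show "bnd (\<lambda>x y. (1 / 4 ^ m) * mm A B x y) (a * b / 4 ^ m)"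
      using bnd_scale [OF bnd_mm [OF A(1) B], of "1 / 4 ^ m"] by simp
    fix x y assume "x \<in> S" "y \<in> S"
    then have o: "(\<Sum>z\<in>S. one x z * f z) = f x" "(\<Sum>z\<in>S. f z * one z y) = f y" for f :: "'a \<Rightarrow> real"
      by (simp_all add: one_def if_distrib [of "\<lambda>t. t * _"] if_distrib [of "\<lambda>t. _ * t"] cong: if_cong)
    have four: "(4::real) ^ m = 2 ^ m * 2 ^ m"
      by (simp add: power_mult_distrib [symmetric])
    have "?X x y = (\<Sum>z\<in>S. one x z * euler B m z y + (A x z / 2 ^ m) * one z y
        + (1 / 4 ^ m) * (A x z * B z y))"
      unfolding mm_def by (rule sum.cong) (simp_all add: euler_def four algebra_simps)
    also have "\<dots> = (\<Sum>z\<in>S. one x z * euler B m z y) + (\<Sum>z\<in>S. (A x z / 2 ^ m) * one z y)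
        + (1 / 4 ^ m) * mm A B x y"
      by (simp only: sum.distrib mm_def sum_distrib_left)
    finally have "?X x y = (\<Sum>z\<in>S. one x z * euler B m z y) + (\<Sum>z\<in>S. (A x z / 2 ^ m) * one z y)
        + (1 / 4 ^ m) * mm A B x y" .
    then show "(1 / 4 ^ m) * mm A B x y = ?X x y - ?Y x y"
      unfolding o by (simp add: euler_def add_divide_distrib)
  qed
  have "bnd (\<lambda>x y. pp ?X m x y - pp ?Y m x y) (2 ^ m * ?c ^ (2 ^ m) * (a * b / 4 ^ m))"
    using A B by (intro bnd_pp_diff [OF 1 2 _ 3]) auto
  moreover have "?c ^ (2 ^ m) = exp (a + b)"
    by (simp add: exp_of_nat_mult [symmetric])
  moreover have "2 ^ m * exp (a + b) * (a * b / 4 ^ m) = exp (a + b) * (a * b) / 2 ^ m"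
  proof -
    have "(4::real) ^ m = 2 ^ m * 2 ^ m"
      by (simp add: power_mult_distrib [symmetric])
    then show ?thesis by simp
  qed
  ultimately show ?thesis by simp
qed

subsection \<open>The spectral theorem\<close>

lemma tp_eq_iff: "tp A = A \<longleftrightarrow> (\<forall>x y. A x y = A y x)"
  unfolding tp_def fun_eq_iff by metis

definition ip :: "('a \<Rightarrow> real) \<Rightarrow> ('a \<Rightarrow> real) \<Rightarrow> real" where
  "ip f g = (\<Sum>x\<in>S. f x * g x)"

definition app :: "('a \<Rightarrow> 'a \<Rightarrow> real) \<Rightarrow> ('a \<Rightarrow> real) \<Rightarrow> 'a \<Rightarrow> real" where
  "app K f = (\<lambda>x. \<Sum>y\<in>S. K x y * f y)"

definition eigenfamily :: "('a \<Rightarrow> 'a \<Rightarrow> real) \<Rightarrow> nat \<Rightarrow> (nat \<Rightarrow> 'a \<Rightarrow> real) \<Rightarrow> (nat \<Rightarrow> real) \<Rightarrow> bool" where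
  "eigenfamily A d u l \<longleftrightarrow>
    (\<forall>i<d. \<forall>j<d. ip (u i) (u j) = (if i = j then 1 else 0)) \<and>
    (\<forall>i<d. \<forall>x\<in>S. app A (u i) x = l i * u i x)"

text \<open>Completeness is stated as the resolution of the identity on \<open>S\<close>, the form
  in which kernels are expanded. That \<open>d\<close> equals the dimension is a consequence and not
  part of the definition.\<close>

definition eigenbasis :: "('a \<Rightarrow> 'a \<Rightarrow> real) \<Rightarrow> nat \<Rightarrow> (nat \<Rightarrow> 'a \<Rightarrow> real) \<Rightarrow> (nat \<Rightarrow> real) \<Rightarrow> bool" where
  "eigenbasis A d u l \<longleftrightarrow> eigenfamily A d u l \<and>
    (\<forall>x\<in>S. \<forall>y\<in>S. (\<Sum>i<d. u i x * u i y) = one x y)"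

lemma ip_commute: "ip f g = ip g f"
  by (simp add: ip_def mult.commute)

lemma ip_add_left: "ip (\<lambda>x. f x + g x) h = ip f h + ip g h"
  by (simp add: ip_def distrib_right sum.distrib)

lemma ip_diff_left: "ip (\<lambda>x. f x - g x) h = ip f h - ip g h"
  by (simp add: ip_def left_diff_distrib sum_subtractf)

lemma ip_scale_left: "ip (\<lambda>x. c * f x) h = c * ip f h"
  by (simp add: ip_def sum_distrib_left mult.assoc)

lemma ip_add_right: "ip h (\<lambda>x. f x + g x) = ip h f + ip h g"
  by (simp add: ip_commute [of h] ip_add_left)

lemma ip_scale_right: "ip h (\<lambda>x. c * f x) = c * ip h f"
  by (simp add: ip_commute [of h] ip_scale_left)

lemma ip_sum_left: "ip (\<lambda>x. \<Sum>i\<in>I. f i x) h = (\<Sum>i\<in>I. ip (f i) h)"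
  by (simp add: ip_def sum_distrib_right) (rule sum.swap)

lemma ip_self_nonneg: "0 \<le> ip f f"
  by (simp add: ip_def sum_nonneg)

lemma ip_self_eq_0: "ip f f = 0 \<longleftrightarrow> (\<forall>x\<in>S. f x = 0)"
  by (simp add: ip_def sum_nonneg_eq_0_iff)

lemma ip_cong: "(\<And>x. x \<in> S \<Longrightarrow> f x = f' x) \<Longrightarrow> (\<And>x. x \<in> S \<Longrightarrow> g x = g' x) \<Longrightarrow> ip f g = ip f' g'"
  by (simp add: ip_def)

lemma app_add: "app K (\<lambda>x. f x + c * g x) = (\<lambda>x. app K f x + c * app K g x)"
  by (simp add: app_def distrib_left sum.distrib sum_distrib_left mult.left_commute)

lemma app_scale: "app K (\<lambda>x. c * f x) = (\<lambda>x. c * app K f x)"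
  by (simp add: app_def sum_distrib_left mult.left_commute)

lemma ip_app:
  assumes "\<And>x y. x \<in> S \<Longrightarrow> y \<in> S \<Longrightarrow> A x y = A y x"
  shows "ip (app A f) g = ip f (app A g)"
proof -
  have "ip (app A f) g = (\<Sum>x\<in>S. \<Sum>y\<in>S. A x y * f y * g x)"
    by (simp add: ip_def app_def sum_distrib_right)
  also have "\<dots> = (\<Sum>y\<in>S. \<Sum>x\<in>S. A x y * f y * g x)"
    by (rule sum.swap)
  also have "\<dots> = (\<Sum>y\<in>S. \<Sum>x\<in>S. f y * (A y x * g x))"
    by (intro sum.cong refl) (simp add: assms mult_ac)
  finally show ?thesis
    by (simp add: ip_def app_def sum_distrib_left)
qed

lemma ip_point: "x \<in> S \<Longrightarrow> ip (one x) f = f x"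
  by (simp add: ip_def one_def if_distrib [of "\<lambda>t. t * _"] cong: if_cong)

text \<open>The row \<open>one x\<close> is the point mass at \<open>x\<close>, and the function
  here is what its projection onto the family leaves over. It yields Bessel's inequality and, when
  nonzero, a start for a further eigenvector.\<close>

lemma residual_orthogonal:
  assumes "eigenfamily A d u l" "x \<in> S" "j < d"
  shows "ip (\<lambda>y. one x y - (\<Sum>i<d. u i x * u i y)) (u j) = 0"
proof -
  have "(\<Sum>i<d. u i x * ip (u i) (u j)) = (\<Sum>i<d. if i = j then u i x else 0)"
    using assms by (intro sum.cong) (auto simp: eigenfamily_def)
  then show ?thesis
    using assms by (simp add: ip_diff_left ip_sum_left ip_scale_left ip_point)
qed

text \<open>Bessel's inequality for the point masses, summed over \<open>S\<close>, bounds the sum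
  of the \<open>d\<close> squared norms, each of which is 1.\<close>

lemma eigenfamily_card:
  assumes "eigenfamily A d u l"
  shows "d \<le> card S"
proof -
  have bessel: "(\<Sum>i<d. (u i x)\<^sup>2) \<le> 1" if x: "x \<in> S" for x
  proof -
    let ?f = "\<lambda>y. one x y - (\<Sum>i<d. u i x * u i y)"
    have "ip ?f ?f = ip (one x) ?f - ip (\<lambda>y. \<Sum>i<d. u i x * u i y) ?f"
      by (rule ip_diff_left)
    also have "ip (\<lambda>y. \<Sum>i<d. u i x * u i y) ?f = 0"
      using residual_orthogonal [OF assms x]
      by (simp add: ip_sum_left ip_scale_left ip_commute [of "u _"])
    also have "ip (one x) ?f = 1 - (\<Sum>i<d. (u i x)\<^sup>2)"
      using x by (simp add: ip_point) (simp add: one_def power2_eq_square)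
    finally show ?thesis using ip_self_nonneg [of ?f] by simp
  qed
  have "real d = (\<Sum>i<d. ip (u i) (u i))"
    using assms by (simp add: eigenfamily_def)
  also have "\<dots> = (\<Sum>x\<in>S. \<Sum>i<d. (u i x)\<^sup>2)"
    by (subst sum.swap) (simp add: ip_def power2_eq_square)
  also have "\<dots> \<le> (\<Sum>x\<in>S. 1)"
    by (intro sum_mono bessel)
  finally show ?thesis by simp
qed

text \<open>Functions live on the whole type with the product topology. Demanding that they vanish
  off \<open>S\<close> places the unit sphere inside a product of compact sets, which is compact by
  Tychonoff's theorem.\<close>

lemma compact_unit_sphere:
  "compact {f. (\<forall>x. x \<notin> S \<longrightarrow> f x = 0) \<and> ip f f = 1 \<and> (\<forall>i<d. ip f (u i) = 0)}" (is "compact ?C")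
proof -
  let ?I = "\<lambda>x. if x \<in> S then {-1..1} else {0::real}"
  have cont: "continuous_on UNIV (\<lambda>f. ip f g)" "continuous_on UNIV (\<lambda>f. ip f f)" for g
    unfolding ip_def by (intro continuous_intros continuous_on_product_coordinates)+
  have "compactin (product_topology (\<lambda>x. euclidean) UNIV) (PiE UNIV ?I)"
    by (subst compactin_PiE) auto
  then have "compact (PiE UNIV ?I)"
    by (simp add: euclidean_product_topology)
  moreover have "closed ({f. ip f f = 1} \<inter> (\<Inter>i\<in>{..<d}. {f. ip f (u i) = 0}))"
    by (intro closed_Int closed_INT ballI closed_Collect_eq continuous_intros cont)
  ultimately have "compact (PiE UNIV ?I \<inter> ({f. ip f f = 1} \<inter> (\<Inter>i\<in>{..<d}. {f. ip f (u i) = 0})))"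
    by (rule compact_Int_closed)
  also have "PiE UNIV ?I \<inter> ({f. ip f f = 1} \<inter> (\<Inter>i\<in>{..<d}. {f. ip f (u i) = 0})) = ?C"
  proof -
    have "f x \<in> ?I x" if f: "\<forall>x. x \<notin> S \<longrightarrow> f x = 0" "ip f f = 1" for f x
    proof (cases "x \<in> S")
      case True
      then have "f x * f x \<le> ip f f"
        unfolding ip_def by (intro member_le_sum) auto
      then have "\<bar>f x\<bar> \<le> 1"
        using f(2) by (simp add: power2_eq_square [symmetric] abs_square_le_1)
      then show ?thesis using True by auto
    qed (use f in auto)
    moreover have "f x = 0" if "\<forall>x. f x \<in> ?I x" "x \<notin> S" for f x
      using that(1)[THEN spec, of x] that(2) by simp
    ultimately have key: "f \<in> PiE UNIV ?I \<and> ip f f = 1 \<longleftrightarrow> (\<forall>x. x \<notin> S \<longrightarrow> f x = 0) \<and> ip f f = 1" for f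
      by (simp only: PiE_iff extensional_UNIV) (metis UNIV_I)
    show ?thesis
    proof (rule Set.set_eqI)
      fix f
      show "f \<in> PiE UNIV ?I \<inter> ({f. ip f f = 1} \<inter> (\<Inter>i\<in>{..<d}. {f. ip f (u i) = 0})) \<longleftrightarrow> f \<in> ?C"
        using key [of f]
        by (simp only: Int_iff INT_iff mem_Collect_eq lessThan_iff Ball_def) argo
    qed
  qed
  finally show ?thesis .
qed

text \<open>The quadratic form of \<open>A\<close> attains its maximum on the unit sphere of the
  orthogonal complement of the family, and a maximiser is an eigenvector. The function
  \<open>f\<close> witnesses that the complement is not zero.\<close>

lemma eigenfamily_extend:
  assumes sym: "\<And>x y. x \<in> S \<Longrightarrow> y \<in> S \<Longrightarrow> A x y = A y x"
    and E: "eigenfamily A d u l"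
    and f: "\<And>i. i < d \<Longrightarrow> ip f (u i) = 0" and x0: "x0 \<in> S" "f x0 \<noteq> 0"
  obtains u' l' where "eigenfamily A (Suc d) u' l'"
proof -
  define C where "C = {f. (\<forall>x. x \<notin> S \<longrightarrow> f x = 0) \<and> ip f f = 1 \<and> (\<forall>i<d. ip f (u i) = 0)}"
  define q where "q f = ip f (app A f)" for f
  \<comment> \<open>Besides scaling, values off \<open>S\<close> have to be cut to 0; inner products
    do not see the change.\<close>
  have normalize: "(\<lambda>x. (1 / sqrt (ip g g)) * (if x \<in> S then g x else 0)) \<in> C"
    if g: "\<And>i. i < d \<Longrightarrow> ip g (u i) = 0" "ip g g > 0" for g
  proof -
    let ?g = "\<lambda>x. if x \<in> S then g x else 0"
    let ?c = "1 / sqrt (ip g g)"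
    have eq: "ip ?g h = ip g h" "ip h ?g = ip h g" for h by (auto intro: ip_cong)
    have "?c * (?c * ip g g) = 1" using g(2) by simp
    then show ?thesis
      unfolding C_def mem_Collect_eq ip_scale_left ip_scale_right eq using g(1) by simp
  qed
  have "ip f f > 0"
    using ip_self_nonneg [of f] ip_self_eq_0 [of f] x0 by fastforce
  then have "C \<noteq> {}" using normalize f by blast
  moreover have "compact C" unfolding C_def by (rule compact_unit_sphere)
  moreover have "continuous_on C q"
    unfolding q_def ip_def app_def
    by (intro continuous_intros continuous_on_subset [OF continuous_on_product_coordinates subset_UNIV])
  ultimately obtain v where v: "v \<in> C" and max: "\<And>g. g \<in> C \<Longrightarrow> q g \<le> q v"
    using continuous_attains_sup by metis
  define m where "m = q v"
  have vo: "\<And>i. i < d \<Longrightarrow> ip v (u i) = 0" and v1: "ip v v = 1"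
    using v by (auto simp: C_def)
  have le: "q g \<le> m * ip g g" if g: "\<And>i. i < d \<Longrightarrow> ip g (u i) = 0" for g
  proof (cases "ip g g > 0")
    case True
    let ?g = "\<lambda>x. (1 / sqrt (ip g g)) * (if x \<in> S then g x else 0)"
    have "app A ?g = (\<lambda>x. (1 / sqrt (ip g g)) * app A g x)"
      by (subst app_scale) (simp add: app_def)
    then have "q ?g = (1 / sqrt (ip g g)) * ((1 / sqrt (ip g g)) * q g)"
      unfolding q_def
      by (simp only: ip_scale_left ip_scale_right) (simp add: ip_def)
    then have "q ?g = q g / ip g g" using True by simp
    moreover have "q ?g \<le> m" unfolding m_def by (intro max normalize g True)
    ultimately show ?thesis using True by (simp add: pos_divide_le_eq)
  next
    case False
    then have "ip g g = 0" using ip_self_nonneg [of g] by simp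
    then show ?thesis by (simp add: q_def ip_self_eq_0) (simp add: ip_def)
  qed
  define r where "r = (\<lambda>x. app A v x - m * v x)"
  have ro: "ip r (u i) = 0" if i: "i < d" for i
  proof -
    have "ip (app A v) (u i) = ip v (app A (u i))" by (rule ip_app [OF sym])
    also have "\<dots> = ip v (\<lambda>x. l i * u i x)"
      using E i by (intro ip_cong) (auto simp: eigenfamily_def)
    also have "\<dots> = 0" using vo i by (simp add: ip_scale_right)
    finally show ?thesis using vo i by (simp add: r_def ip_diff_left ip_scale_left)
  qed
  \<comment> \<open>Moving the maximiser \<open>v\<close> in the direction of its residual
    \<open>r\<close> gains a term of first order in \<open>s\<close> and loses one of second order,
    so small \<open>s\<close> will force \<open>r\<close> to vanish on \<open>S\<close>.\<close>
  have ineq: "2 * s * ip r r \<le> s\<^sup>2 * (m * ip r r - q r)" for s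
  proof -
    let ?g = "\<lambda>x. v x + s * r x"
    have rr: "ip r r = ip r (app A v) - m * ip r v"
      by (subst (2) r_def) (simp add: ip_commute [of r] ip_diff_left ip_scale_left)
    have sym': "ip v (app A r) = ip r (app A v)"
      using ip_app [of A v r] sym by (simp add: ip_commute)
    have "q ?g = m + 2 * s * ip r (app A v) + s\<^sup>2 * q r"
      unfolding q_def app_add
      by (simp add: ip_add_left ip_add_right ip_scale_left ip_scale_right sym' m_def q_def
          power2_eq_square algebra_simps)
    moreover have "ip ?g ?g = 1 + 2 * s * ip r v + s\<^sup>2 * ip r r"
      by (simp add: ip_add_left ip_add_right ip_scale_left ip_scale_right v1 ip_commute [of v r]
          power2_eq_square algebra_simps)
    moreover have "q ?g \<le> m * ip ?g ?g"
      by (rule le) (simp add: ip_add_left ip_scale_left vo ro)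
    ultimately have "m + 2 * s * ip r (app A v) + s\<^sup>2 * q r \<le> m * (1 + 2 * s * ip r v + s\<^sup>2 * ip r r)"
      by simp
    then show ?thesis unfolding rr by (simp add: algebra_simps)
  qed
  have "ip r r = 0"
  proof (rule ccontr)
    assume "ip r r \<noteq> 0"
    then have a: "ip r r > 0" using ip_self_nonneg [of r] by simp
    \<comment> \<open>An upper bound for the second-order coefficient, made positive by adding 1, so
      that \<open>ip r r / b\<close> can be taken for \<open>s\<close>.\<close>
    define b where "b = \<bar>m * ip r r - q r\<bar> + 1"
    have b: "b > 0" "m * ip r r - q r \<le> b" by (auto simp: b_def)
    have "2 * (ip r r / b) * ip r r \<le> (ip r r / b)\<^sup>2 * (m * ip r r - q r)" by (rule ineq)
    also have "\<dots> \<le> (ip r r / b)\<^sup>2 * b" using b by (intro mult_left_mono) auto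
    finally have "2 * (ip r r)\<^sup>2 \<le> (ip r r)\<^sup>2"
      using b by (simp add: power2_eq_square field_simps)
    then show False using a by simp
  qed
  then have eig: "app A v x = m * v x" if "x \<in> S" for x
    using that by (simp add: ip_self_eq_0 r_def)
  have "eigenfamily A (Suc d) (u(d := v)) (l(d := m))"
    unfolding eigenfamily_def
  proof (intro conjI allI impI ballI)
    fix i j assume "i < Suc d" "j < Suc d"
    then show "ip ((u(d := v)) i) ((u(d := v)) j) = (if i = j then 1 else 0)"
      using E vo v1 by (auto simp: eigenfamily_def less_Suc_eq ip_commute [of "u _" v])
  next
    fix i x assume "i < Suc d" "x \<in> S"
    then show "app A ((u(d := v)) i) x = (l(d := m)) i * (u(d := v)) i x"
      using E eig by (auto simp: eigenfamily_def less_Suc_eq)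
  qed
  then show ?thesis by (rule that)
qed

text \<open>A family of greatest size exists because its size is at most \<open>card S\<close>. It
  is complete, since a nonzero residual of a point mass would allow it to be extended.\<close>

theorem spectral_theorem:
  assumes sym: "\<And>x y. x \<in> S \<Longrightarrow> y \<in> S \<Longrightarrow> A x y = A y x"
  obtains d u l where "eigenbasis A d u l"
proof -
  let ?Q = "\<lambda>d. \<exists>u l. eigenfamily A d u l"
  have "?Q 0" by (simp add: eigenfamily_def)
  moreover have "\<forall>d. ?Q d \<longrightarrow> d \<le> card S" using eigenfamily_card by blast
  ultimately have d: "?Q (Greatest ?Q)" and max: "d' \<le> Greatest ?Q" if "?Q d'" for d'
    using GreatestI_nat [of ?Q 0 "card S"] Greatest_le_nat [of ?Q d' "card S"] that by blast+
  define d where "d = Greatest ?Q"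
  from d [OF \<open>?Q 0\<close>] obtain u l where E: "eigenfamily A d u l" unfolding d_def by blast
  have "(\<Sum>i<d. u i x * u i y) = one x y" if xy: "x \<in> S" "y \<in> S" for x y
  proof (rule ccontr)
    assume ne: "(\<Sum>i<d. u i x * u i y) \<noteq> one x y"
    show False
    proof (rule eigenfamily_extend [OF sym E residual_orthogonal [OF E xy(1)] xy(2)])
      show "one x y - (\<Sum>i<d. u i x * u i y) \<noteq> 0" using ne by simp
      fix u' l' assume "eigenfamily A (Suc d) u' l'"
      then have "Suc d \<le> d" unfolding d_def by (intro max) blast
      then show False by simp
    qed
  qed
  then have "eigenbasis A d u l" using E by (simp add: eigenbasis_def)
  then show ?thesis by (rule that)
qed

lemma eigenbasis_expand:
  assumes "eigenbasis A d u l" "x \<in> S" "y \<in> S"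
  shows "A x y = (\<Sum>i<d. l i * u i x * u i y)"
proof -
  have "A x y = (\<Sum>z\<in>S. A x z * one z y)"
    using assms by (simp add: one_def if_distrib [of "\<lambda>t. _ * t"] cong: if_cong)
  also have "\<dots> = (\<Sum>z\<in>S. \<Sum>i<d. A x z * u i z * u i y)"
    using assms by (intro sum.cong refl)
      (simp add: eigenbasis_def sum_distrib_left mult.assoc flip: sum_distrib_left)
  also have "\<dots> = (\<Sum>i<d. app A (u i) x * u i y)"
    by (subst sum.swap) (simp add: app_def sum_distrib_right)
  also have "\<dots> = (\<Sum>i<d. l i * u i x * u i y)"
    using assms by (intro sum.cong refl) (auto simp: eigenbasis_def eigenfamily_def)
  finally show ?thesis .
qed

lemma eigenbasis_mm:
  assumes E: "eigenbasis A d u l"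
    and K: "\<And>x y. x \<in> S \<Longrightarrow> y \<in> S \<Longrightarrow> K x y = (\<Sum>i<d. a i * u i x * u i y)"
    and L: "\<And>x y. x \<in> S \<Longrightarrow> y \<in> S \<Longrightarrow> L x y = (\<Sum>i<d. b i * u i x * u i y)"
    and xy: "x \<in> S" "y \<in> S"
  shows "mm K L x y = (\<Sum>i<d. a i * b i * u i x * u i y)"
proof -
  have "mm K L x y = (\<Sum>z\<in>S. (\<Sum>i<d. a i * u i x * u i z) * (\<Sum>j<d. b j * u j z * u j y))"
    unfolding mm_def by (intro sum.cong refl) (simp add: K L xy)
  also have "\<dots> = (\<Sum>z\<in>S. \<Sum>i<d. \<Sum>j<d. a i * b j * u i x * u j y * (u i z * u j z))"
    by (simp add: sum_product algebra_simps)
  also have "\<dots> = (\<Sum>i<d. \<Sum>z\<in>S. \<Sum>j<d. a i * b j * u i x * u j y * (u i z * u j z))"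
    by (rule sum.swap)
  also have "\<dots> = (\<Sum>i<d. \<Sum>j<d. \<Sum>z\<in>S. a i * b j * u i x * u j y * (u i z * u j z))"
    by (intro sum.cong refl sum.swap)
  also have "\<dots> = (\<Sum>i<d. \<Sum>j<d. a i * b j * u i x * u j y * ip (u i) (u j))"
    by (simp add: ip_def sum_distrib_left)
  also have "\<dots> = (\<Sum>i<d. \<Sum>j<d. if i = j then a i * b i * u i x * u i y else 0)"
    using E by (intro sum.cong refl) (auto simp: eigenbasis_def eigenfamily_def)
  finally show ?thesis by simp
qed

lemma eigenbasis_tr:
  assumes E: "eigenbasis A d u l"
    and K: "\<And>x. x \<in> S \<Longrightarrow> K x x = (\<Sum>i<d. a i * u i x * u i x)"
  shows "tr K = (\<Sum>i<d. a i)"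
proof -
  have "tr K = (\<Sum>i<d. a i * ip (u i) (u i))"
    by (simp add: tr_def K ip_def sum_distrib_left mult.assoc) (rule sum.swap)
  also have "\<dots> = (\<Sum>i<d. a i)"
    using E by (intro sum.cong refl) (auto simp: eigenbasis_def eigenfamily_def)
  finally show ?thesis .
qed

lemma eigenbasis_pp:
  assumes E: "eigenbasis A d u l"
    and K: "\<And>x y. x \<in> S \<Longrightarrow> y \<in> S \<Longrightarrow> K x y = (\<Sum>i<d. a i * u i x * u i y)"
    and xy: "x \<in> S" "y \<in> S"
  shows "pp K m x y = (\<Sum>i<d. a i ^ (2 ^ m) * u i x * u i y)"
  using xy
proof (induction m arbitrary: x y)
  case (Suc m)
  have "pp K (Suc m) x y = (\<Sum>i<d. a i ^ (2 ^ m) * a i ^ (2 ^ m) * u i x * u i y)"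
    using eigenbasis_mm [OF E Suc.IH Suc.IH] Suc.prems by simp
  then show ?case by (simp add: mult_2 power_add)
qed (simp add: K)

subsection \<open>Exponentials and the Golden-Thompson inequality\<close>

text \<open>Being an entrywise limit of powers of Euler steps, it inherits invariance and support
  from these steps. Convergence is proved for symmetric \<open>A\<close>; where the sequence
  diverges, \<open>lim\<close> is unspecified.\<close>

definition expk :: "('a \<Rightarrow> 'a \<Rightarrow> real) \<Rightarrow> 'a \<Rightarrow> 'a \<Rightarrow> real" where
  "expk A x y = lim (\<lambda>m. pp (euler A m) m x y)"

lemma tendsto_power_two_exp: "(\<lambda>m. (1 + x / 2 ^ m) ^ (2 ^ m)) \<longlonglongrightarrow> exp (x::real)"
proof -
  have "strict_mono (\<lambda>m. 2 ^ m :: nat)"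
    by (simp add: strict_mono_def power_strict_increasing)
  from LIMSEQ_subseq_LIMSEQ [OF tendsto_exp_limit_sequentially this]
  show ?thesis by (simp add: o_def)
qed

lemma
  assumes E: "eigenbasis A d u l" and xy: "x \<in> S" "y \<in> S"
  shows euler_tendsto_spectral: "(\<lambda>m. pp (euler A m) m x y) \<longlonglongrightarrow> (\<Sum>i<d. exp (l i) * u i x * u i y)"
    and expk_spectral: "expk A x y = (\<Sum>i<d. exp (l i) * u i x * u i y)"
proof -
  have "euler A m x y = (\<Sum>i<d. (1 + l i / 2 ^ m) * u i x * u i y)" if "x \<in> S" "y \<in> S" for m x y
    using eigenbasis_expand [OF E that] E that
    by (simp add: euler_def eigenbasis_def distrib_right sum.distrib sum_divide_distrib)
  from eigenbasis_pp [OF E this _ _]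
  have "(\<lambda>m. pp (euler A m) m x y) = (\<lambda>m. \<Sum>i<d. (1 + l i / 2 ^ m) ^ 2 ^ m * u i x * u i y)"
    using xy by blast
  then show 1: "(\<lambda>m. pp (euler A m) m x y) \<longlonglongrightarrow> (\<Sum>i<d. exp (l i) * u i x * u i y)"
    by (simp only:) (intro tendsto_intros tendsto_power_two_exp)
  then show "expk A x y = (\<Sum>i<d. exp (l i) * u i x * u i y)"
    unfolding expk_def by (rule limI)
qed

lemma euler_tendsto_expk:
  assumes "tp A = A" "x \<in> S" "y \<in> S"
  shows "(\<lambda>m. pp (euler A m) m x y) \<longlonglongrightarrow> expk A x y"
proof -
  have "A x y = A y x" for x y using assms(1) unfolding tp_eq_iff by blast
  then obtain d u l where E: "eigenbasis A d u l" using spectral_theorem [of A] by blast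
  then show ?thesis using euler_tendsto_spectral [OF E] expk_spectral [OF E] assms by simp
qed

lemma expk_diag_nonneg:
  assumes "tp A = A" "x \<in> S"
  shows "0 \<le> expk A x x"
proof -
  have "A x y = A y x" for x y using assms(1) unfolding tp_eq_iff by blast
  then obtain d u l where E: "eigenbasis A d u l" using spectral_theorem [of A] by blast
  show ?thesis
    unfolding expk_spectral [OF E assms(2) assms(2)] mult.assoc
    by (intro sum_nonneg) simp
qed

lemma tp_euler:
  assumes "tp A = A"
  shows "tp (euler A m) = euler A m"
proof -
  have "tp (euler A m) = euler (tp A) m"
    by (auto simp: tp_def euler_def one_def fun_eq_iff)
  then show ?thesis using assms by simp
qed

text \<open>For each \<open>m\<close>, replacing the Euler step of the sum by the product of two
  steps costs an error that vanishes in the limit, and \<open>trace_power_product_le\<close>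
  separates the factors. The limit \<open>m \<rightarrow> \<infinity>\<close> gives the
  exponentials.\<close>

theorem Golden_Thompson:
  assumes A: "tp A = A" and B: "tp B = B"
  shows "tr (expk (\<lambda>x y. A x y + B x y)) \<le> tr (mm (expk A) (expk B))"
proof -
  let ?AB = "\<lambda>x y. A x y + B x y"
  obtain a where a: "0 \<le> a" "bnd A a" using ex_bnd by blast
  obtain b where b: "0 \<le> b" "bnd B b" using ex_bnd by blast
  define e where "e = real (card S) * (exp (a + b) * (a * b))"
  have sA: "A x y = A y x" and sB: "B x y = B y x" for x y
    using A B unfolding tp_eq_iff by blast+
  have AB: "tp ?AB = ?AB" unfolding tp_eq_iff using sA sB by metis
  have le: "tr (pp (euler ?AB m) m) \<le> tr (mm (pp (euler A m) m) (pp (euler B m) m)) + e / 2 ^ m" for m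
  proof -
    let ?X = "pp (mm (euler A m) (euler B m)) m" and ?Y = "pp (euler ?AB m) m"
    have "tr (\<lambda>x y. ?X x y - ?Y x y) = tr ?X - tr ?Y"
      by (simp add: tr_def sum_subtractf)
    then have "tr ?Y \<le> tr ?X + e / 2 ^ m"
      using abs_tr_le [OF Trotter_error [OF a(2,1) b(2,1), of m]] by (simp add: e_def)
    also have "tr ?X \<le> tr (mm (pp (euler A m) m) (pp (euler B m) m))"
    proof (rule trace_power_product_le)
      show "tp (euler A m) = euler A m" "tp (euler B m) = euler B m"
        using A B by (simp_all add: tp_euler)
    qed
    finally show ?thesis by simp
  qed
  have "(\<lambda>m. e * (1 / 2) ^ m) \<longlonglongrightarrow> e * 0"
    by (intro tendsto_intros) simp_all
  then have err: "(\<lambda>m. e / 2 ^ m) \<longlonglongrightarrow> 0"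
    by (simp add: power_divide)
  have lim: "(\<lambda>m. tr (mm (pp (euler A m) m) (pp (euler B m) m)) + e / 2 ^ m)
      \<longlonglongrightarrow> tr (mm (expk A) (expk B)) + 0"
    unfolding tr_def mm_def by (intro tendsto_intros euler_tendsto_expk err A B)
  have "(\<lambda>m. tr (pp (euler ?AB m) m)) \<longlonglongrightarrow> tr (expk ?AB)"
    unfolding tr_def by (intro tendsto_intros euler_tendsto_expk AB)
  then have "tr (expk ?AB) \<le> tr (mm (expk A) (expk B)) + 0"
    by (rule LIMSEQ_le [OF _ lim]) (use le in blast)
  then show ?thesis by simp
qed

end

section \<open>Transvections of SL n\<close>

lemma bit_double: "(a::bit) + a = 0" "a + (a + b) = b"
  by (cases a; cases b; simp)+

declare add_bit_eq_xor [simp del] mult_bit_eq_and [simp del]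

text \<open>\<open>inverts_mat\<close> reads the size of the identity off its factors; the two
  products together force the inverse to be of size n by n.\<close>

lemma SL_iff:
  "x \<in> SL n \<longleftrightarrow>
    x \<in> carrier_mat n n \<and> (\<exists>y\<in>carrier_mat n n. x * y = 1\<^sub>m n \<and> y * x = 1\<^sub>m n)"
proof
  assume "x \<in> SL n"
  then obtain y where y: "inverts_mat x y" "inverts_mat y x" and x: "x \<in> carrier_mat n n"
    by (auto simp: SL_def invertible_mat_def)
  have 1: "x * y = 1\<^sub>m n" using y x by (simp add: inverts_mat_def)
  then have c: "dim_col y = n" by (metis index_mult_mat(3) index_one_mat(3))
  have 2: "y * x = 1\<^sub>m (dim_row y)" using y by (simp add: inverts_mat_def)
  then have "dim_row y = n" using x by (metis carrier_matD(2) index_mult_mat(3) index_one_mat(3))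
  then show "x \<in> carrier_mat n n \<and> (\<exists>y\<in>carrier_mat n n. x * y = 1\<^sub>m n \<and> y * x = 1\<^sub>m n)"
    using x c 1 2 by auto
qed (auto simp: SL_def invertible_mat_def inverts_mat_def)

lemma SL_carrier: "x \<in> SL n \<Longrightarrow> x \<in> carrier_mat n n"
  by (simp add: SL_def)

lemma SL_inverse:
  assumes "x \<in> SL n"
  obtains y where "y \<in> SL n" "x * y = 1\<^sub>m n" "y * x = 1\<^sub>m n"
  using assms by (auto simp: SL_iff)

lemma SL_one: "1\<^sub>m n \<in> SL n"
  by (auto simp: SL_iff)

lemma SL_assoc: "x \<in> SL n \<Longrightarrow> y \<in> SL n \<Longrightarrow> z \<in> SL n \<Longrightarrow> x * y * z = x * (y * z)"
  by (rule assoc_mult_mat [OF SL_carrier SL_carrier SL_carrier])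

lemma SL_mult:
  assumes x: "x \<in> SL n" and y: "y \<in> SL n"
  shows "x * y \<in> SL n"
proof -
  note c = SL_carrier
  obtain x' where x': "x' \<in> SL n" "x * x' = 1\<^sub>m n" "x' * x = 1\<^sub>m n" using SL_inverse x by blast
  obtain y' where y': "y' \<in> SL n" "y * y' = 1\<^sub>m n" "y' * y = 1\<^sub>m n" using SL_inverse y by blast
  have cancel: "(a * b) * (b' * a') = 1\<^sub>m n"
    if "a \<in> SL n" "b \<in> SL n" "a' \<in> SL n" "b' \<in> SL n" "a * a' = 1\<^sub>m n" "b * b' = 1\<^sub>m n" for a b a' b'
  proof -
    have "b * (b' * a') = a'"
      using assoc_mult_mat [OF c [OF that(2)] c [OF that(4)] c [OF that(3)]] that(6)
        left_mult_one_mat [OF c [OF that(3)]] by simp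
    moreover have "(a * b) * (b' * a') = a * (b * (b' * a'))"
      by (rule assoc_mult_mat [OF c [OF that(1)] c [OF that(2)] mult_carrier_mat [OF c [OF that(4)] c [OF that(3)]]])
    ultimately show ?thesis using that by simp
  qed
  have 1: "(x * y) * (y' * x') = 1\<^sub>m n"
    by (rule cancel [OF x y x'(1) y'(1) x'(2) y'(2)])
  have "(y' * x') * (x * y) = 1\<^sub>m n"
    by (rule cancel [OF y'(1) x'(1) y x y'(3) x'(3)])
  then show ?thesis
    unfolding SL_iff using 1 x y x' y' by (blast intro: mult_carrier_mat [of _ n n _ n] c)
qed

text \<open>A matrix of bits is determined by the set of positions of its ones, which embeds
  \<open>SL n\<close> into the subsets of a set of size \<open>n * n\<close>.\<close>

lemma
  shows finite_SL: "finite (SL n)" and card_SL_le: "card (SL n) \<le> 2 ^ (n * n)"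
proof -
  let ?f = "\<lambda>x::bit mat. {(i, j). i < n \<and> j < n \<and> x $$ (i, j) = 1}"
  have inj: "inj_on ?f (SL n)"
  proof (rule inj_onI)
    fix x y assume xy: "x \<in> SL n" "y \<in> SL n" and eq: "?f x = ?f y"
    have "x $$ (i, j) = y $$ (i, j)" if "i < n" "j < n" for i j
    proof -
      have "(i, j) \<in> ?f x \<longleftrightarrow> (i, j) \<in> ?f y" using eq by simp
      then have "x $$ (i, j) = 1 \<longleftrightarrow> y $$ (i, j) = 1" using that by simp
      then show ?thesis by (metis bit_not_one_iff)
    qed
    then show "x = y"
      using xy SL_carrier by (intro eq_matI) (auto dest!: SL_carrier)
  qed
  have sub: "?f ` SL n \<subseteq> Pow ({..<n} \<times> {..<n})" by auto
  show "finite (SL n)"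
    by (rule inj_on_finite [OF inj sub]) simp
  have "card (SL n) \<le> card (Pow ({..<n} \<times> {..<n}))"
    by (rule card_inj_on_le [OF inj sub]) simp
  then show "card (SL n) \<le> 2 ^ (n * n)"
    by (simp add: card_Pow card_cartesian_product)
qed

lemma bij_betw_mult_right:
  assumes h: "h \<in> SL n"
  shows "bij_betw (\<lambda>x. x * h) (SL n) (SL n)"
proof -
  obtain k where k: "k \<in> SL n" "h * k = 1\<^sub>m n" "k * h = 1\<^sub>m n"
    using SL_inverse h by blast
  show ?thesis
    by (rule bij_betw_byWitness [where f' = "\<lambda>x. x * k"])
      (use h k in \<open>auto simp: SL_mult SL_assoc right_mult_one_mat [OF SL_carrier]\<close>)
qed

text \<open>From three indices on, every transvection is a commutator of two others, on which both
  spectral bounds rest.\<close>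

locale transvections =
  fixes n :: nat
  assumes n3: "3 \<le> n"
begin

definition pairs :: "(nat \<times> nat) set" where
  "pairs = {(i, j). i < n \<and> j < n \<and> i \<noteq> j}"

definition T :: "nat \<times> nat \<Rightarrow> bit mat" where
  "T p = 1\<^sub>m n + E n (fst p) (snd p)"

text \<open>Acts on the left by adding row \<open>snd p\<close> to row \<open>fst p\<close>, and
  therefore commutes with all right multiplications.\<close>

definition act :: "nat \<times> nat \<Rightarrow> bit mat \<Rightarrow> bit mat" where
  "act p x = T p * x"

lemma T_carrier [simp]: "T p \<in> carrier_mat n n"
  by (simp add: T_def E_def)

lemma act_carrier [simp]: "x \<in> carrier_mat n n \<Longrightarrow> act p x \<in> carrier_mat n n"
  unfolding act_def by (rule mult_carrier_mat [OF T_carrier])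

lemma T_index: "k < n \<Longrightarrow> l < n \<Longrightarrow>
    T (i, j) $$ (k, l) = (if k = l then 1 else 0) + (if k = i \<and> l = j then 1 else 0)"
  by (simp add: T_def E_def)

lemma act_index:
  assumes "x \<in> carrier_mat n n" "j < n" "k < n" "l < n"
  shows "act (i, j) x $$ (k, l) = x $$ (k, l) + (if k = i then x $$ (j, l) else 0)"
proof -
  have "act (i, j) x $$ (k, l) = (\<Sum>m = 0..<n. T (i, j) $$ (k, m) * x $$ (m, l))"
    using assms by (simp add: act_def scalar_prod_def carrier_matD [OF T_carrier])
  also have "\<dots> = (\<Sum>m = 0..<n. (if k = m then x $$ (m, l) else 0)
      + (if m = j then if k = i then x $$ (m, l) else 0 else 0))"
    using assms by (intro sum.cong) (auto simp: T_index)
  also have "\<dots> = x $$ (k, l) + (if k = i then x $$ (j, l) else 0)"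
    using assms by (simp add: sum.distrib)
  finally show ?thesis .
qed

lemma act_act:
  assumes "x \<in> carrier_mat n n" "p \<in> pairs"
  shows "act p (act p x) = x"
  using assms
  by (intro eq_matI; cases p) (auto simp: act_index pairs_def carrier_matD [OF act_carrier] carrier_matD add.assoc bit_double)

lemma act_commute:
  assumes "x \<in> carrier_mat n n" "(i, j) \<in> pairs" "(k, l) \<in> pairs" "j \<noteq> k" "i \<noteq> l"
  shows "act (i, j) (act (k, l) x) = act (k, l) (act (i, j) x)"
  using assms
  by (intro eq_matI) (auto simp: act_index pairs_def carrier_matD [OF act_carrier] add_ac bit_double)

text \<open>The Steinberg commutator relation; the generators are involutions, so inverses do not
  show. The two generators span a dihedral group of order 8 with the right side as its
  centre.\<close>

lemma act_commutator:
  assumes "x \<in> carrier_mat n n" "i < n" "j < n" "k < n" "i \<noteq> j" "j \<noteq> k" "i \<noteq> k"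
  shows "act (i, j) (act (j, k) (act (i, j) (act (j, k) x))) = act (i, k) x"
  using assms
  by (intro eq_matI) (auto simp: act_index carrier_matD [OF act_carrier] add_ac bit_double)

lemma T_SL:
  assumes "p \<in> pairs"
  shows "T p \<in> SL n"
proof -
  have "T p * T p = act p (act p (1\<^sub>m n))"
    by (simp add: act_def right_mult_one_mat [OF T_carrier])
  also have "\<dots> = 1\<^sub>m n" using assms by (simp add: act_act)
  finally show ?thesis
    unfolding SL_iff using T_carrier by blast
qed

lemma act_SL: "p \<in> pairs \<Longrightarrow> x \<in> SL n \<Longrightarrow> act p x \<in> SL n"
  unfolding act_def by (intro SL_mult T_SL)

lemma act_mult_right: "x \<in> SL n \<Longrightarrow> h \<in> SL n \<Longrightarrow> act p (x * h) = act p x * h"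
  unfolding act_def by (rule assoc_mult_mat [OF T_carrier SL_carrier SL_carrier, symmetric])

lemma bij_betw_act:
  assumes "p \<in> pairs"
  shows "bij_betw (act p) (SL n) (SL n)"
  by (rule bij_betw_byWitness [where f' = "act p"])
    (use assms in \<open>auto simp: act_act SL_carrier act_SL\<close>)

lemma sum_act: "p \<in> pairs \<Longrightarrow> (\<Sum>x\<in>SL n. f (act p x)) = (\<Sum>x\<in>SL n. f x)"
  using bij_betw_act by (rule sum.reindex_bij_betw)

text \<open>Cancelling the invertible \<open>x\<close> recovers \<open>T p\<close>, whose only
  off-diagonal 1 tells the pair. Distinct generators hence lead to distinct states.\<close>

lemma act_inj:
  assumes "x \<in> SL n" "p \<in> pairs" "q \<in> pairs" "act p x = act q x"
  shows "p = q"
proof -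
  obtain y where y: "y \<in> SL n" "x * y = 1\<^sub>m n" using SL_inverse assms(1) by blast
  have T: "T p = act p x * y" for p
    using assms(1) y by (simp add: act_mult_right [symmetric]) (simp add: act_def right_mult_one_mat [OF T_carrier])
  obtain i j where p: "p = (i, j)" by force
  obtain k l where q: "q = (k, l)" by force
  have "T p = T q" using T [of p] T [of q] assms(4) by (simp only:)
  then have "T p $$ (i, j) = T q $$ (i, j)" by (rule arg_cong)
  moreover have ij: "i < n" "j < n" "i \<noteq> j" using assms(2) by (simp_all add: p pairs_def)
  ultimately have "i = k \<and> j = l"
    unfolding p q T_index [OF ij(1,2)] by (simp split: if_splits)
  then show ?thesis by (simp add: p q)
qed

subsection \<open>Gaussian elimination\<close>

text \<open>Induction on the number of nonzero entries of column \<open>c\<close> outside the pivot.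
  Adding the pivot row removes one of them and keeps the earlier columns, where that row is
  zero.\<close>

lemma act_invariant_clear_column:
  assumes inv: "\<And>p x. p \<in> pairs \<Longrightarrow> x \<in> SL n \<Longrightarrow> f (act p x) = f x"
    and x: "x \<in> SL n" and c: "c < n"
    and cols: "\<And>k l. k < n \<Longrightarrow> l < c \<Longrightarrow> x $$ (k, l) = (if k = l then 1 else 0)"
    and piv: "x $$ (c, c) = 1"
  shows "\<exists>y\<in>SL n. f y = f x \<and>
    (\<forall>k<n. \<forall>l\<le>c. y $$ (k, l) = (if k = l then 1 else 0))"
  using x cols piv
proof (induction "card {k. k < n \<and> k \<noteq> c \<and> x $$ (k, c) \<noteq> 0}" arbitrary: x rule: less_induct)
  case less
  show ?case
  proof (cases "{k. k < n \<and> k \<noteq> c \<and> x $$ (k, c) \<noteq> 0} = {}")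
    case True
    then have col: "x $$ (k, c) = 0" if "k < n" "k \<noteq> c" for k
      using that by blast
    have "x $$ (k, l) = (if k = l then 1 else 0)" if "k < n" "l \<le> c" for k l
    proof (cases "l = c")
      case True
      then show ?thesis using col [OF that(1)] less.prems(3) by simp
    next
      case False
      then show ?thesis using less.prems(2) that by simp
    qed
    then show ?thesis using less.prems(1) by blast
  next
    case False
    then obtain k where k: "k < n" "k \<noteq> c" "x $$ (k, c) \<noteq> 0" by blast
    then have k1: "x $$ (k, c) = 1" by (metis bit_not_zero_iff)
    have p: "(k, c) \<in> pairs" using k c by (simp add: pairs_def)
    let ?x = "act (k, c) x"
    have ix: "?x $$ (a, b) = x $$ (a, b) + (if a = k then x $$ (c, b) else 0)" if "a < n" "b < n" for a b
      using that c less.prems(1) by (simp add: act_index SL_carrier)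
    have del: "{a. a < n \<and> a \<noteq> c \<and> ?x $$ (a, c) \<noteq> 0} = {a. a < n \<and> a \<noteq> c \<and> x $$ (a, c) \<noteq> 0} - {k}"
      using c k1 less.prems(3) by (auto simp: ix split: if_splits)
    have lt: "card {a. a < n \<and> a \<noteq> c \<and> ?x $$ (a, c) \<noteq> 0}
        < card {a. a < n \<and> a \<noteq> c \<and> x $$ (a, c) \<noteq> 0}"
      unfolding del by (rule card_Diff1_less) (use k in auto)
    have cols': "?x $$ (a, b) = (if a = b then 1 else 0)" if "a < n" "b < c" for a b
      using that c less.prems(2) by (auto simp: ix)
    have piv': "?x $$ (c, c) = 1" using c k less.prems(3) by (simp add: ix)
    from less.hyps [OF lt act_SL [OF p less.prems(1)] cols' piv']
    show ?thesis using inv [OF p less.prems(1)] by simp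
  qed
qed

text \<open>Otherwise column \<open>c\<close> would be supported in the first \<open>c\<close> rows.
  Row \<open>c\<close> of the inverse vanishes in the first \<open>c\<close> columns, because the
  earlier columns are unit vectors, and so the product would have a 0 in position (c, c).\<close>

lemma exists_pivot:
  assumes x: "x \<in> SL n" and c: "c < n"
    and cols: "\<And>k l. k < n \<Longrightarrow> l < c \<Longrightarrow> x $$ (k, l) = (if k = l then 1 else 0)"
  shows "\<exists>k<n. c \<le> k \<and> x $$ (k, c) = 1"
proof (rule ccontr)
  assume none: "\<not> ?thesis"
  then have z: "x $$ (k, c) = 0" if "k < n" "c \<le> k" for k
    using that by (metis bit_not_one_iff)
  obtain y where y: "y \<in> SL n" "y * x = 1\<^sub>m n" using SL_inverse x by blast
  have yx: "(\<Sum>m = 0..<n. y $$ (a, m) * x $$ (m, b)) = (if a = b then 1 else 0)" if "a < n" "b < n" for a b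
  proof -
    have "(y * x) $$ (a, b) = (\<Sum>m = 0..<n. y $$ (a, m) * x $$ (m, b))"
      using that SL_carrier [OF x] SL_carrier [OF y(1)] by (simp add: scalar_prod_def)
    then show ?thesis using that y(2) by simp
  qed
  have "y $$ (c, m) = 0" if m: "m < c" for m
  proof -
    have "(\<Sum>a = 0..<n. y $$ (c, a) * x $$ (a, m)) = (\<Sum>a = 0..<n. if a = m then y $$ (c, a) else 0)"
      using m by (intro sum.cong) (auto simp: cols)
    then show ?thesis using yx [of c m] m c by simp
  qed
  then have "(\<Sum>m = 0..<n. y $$ (c, m) * x $$ (m, c)) = 0"
    using z by (intro sum.neutral) (metis atLeastLessThan_iff mult_zero_left mult_zero_right not_le)
  then show False using yx [of c c] c by simp
qed

text \<open>Elementary transvections generate \<open>SL n\<close>, in the form in which it will be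
  applied to eigenfunctions for the eigenvalue 0. Columns are reduced to unit vectors one after the
  other.\<close>

lemma act_invariant_constant:
  assumes inv: "\<And>p x. p \<in> pairs \<Longrightarrow> x \<in> SL n \<Longrightarrow> f (act p x) = f x"
    and x: "x \<in> SL n"
  shows "f x = f (1\<^sub>m n)"
proof -
  have "\<exists>y\<in>SL n. f y = f x \<and> (\<forall>k<n. \<forall>l<c. y $$ (k, l) = (if k = l then 1 else 0))" if "c \<le> n" for c
    using that
  proof (induction c)
    case 0
    then show ?case using x by auto
  next
    case (Suc c)
    then obtain y where y: "y \<in> SL n" "f y = f x"
      and cols: "\<And>k l. k < n \<Longrightarrow> l < c \<Longrightarrow> y $$ (k, l) = (if k = l then 1 else 0)"
      by auto
    have c: "c < n" using Suc.prems by simp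
    obtain k where k: "k < n" "c \<le> k" "y $$ (k, c) = 1"
      using exists_pivot [OF y(1) c cols] by blast
    have "\<exists>z\<in>SL n. f z = f x \<and> z $$ (c, c) = 1 \<and>
      (\<forall>k<n. \<forall>l<c. z $$ (k, l) = (if k = l then 1 else 0))"
    proof (cases "y $$ (c, c) = 1")
      case True
      then show ?thesis using y cols by blast
    next
      case False
      then have y0: "y $$ (c, c) = 0" by (metis bit_not_one_iff)
      then have kc: "k \<noteq> c" using k by auto
      have p: "(c, k) \<in> pairs" using c k kc by (simp add: pairs_def)
      \<comment> \<open>Adding row \<open>k\<close> to row \<open>c\<close> creates the pivot
        without a row exchange; as k > c, row \<open>k\<close> is zero in the columns already
        reduced.\<close>
      let ?z = "act (c, k) y"
      have iz: "?z $$ (a, b) = y $$ (a, b) + (if a = c then y $$ (k, b) else 0)" if "a < n" "b < n" for a b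
        using that k y(1) by (simp add: act_index SL_carrier)
      have "?z $$ (a, b) = (if a = b then 1 else 0)" if "a < n" "b < c" for a b
        using that c k kc cols by (auto simp: iz)
      moreover have "?z $$ (c, c) = 1" using c k y0 by (simp add: iz)
      ultimately show ?thesis using act_SL [OF p y(1)] inv [OF p y(1)] y(2) by metis
    qed
    then obtain z where z: "z \<in> SL n" "f z = f x" "z $$ (c, c) = 1"
      and zc: "\<And>k l. k < n \<Longrightarrow> l < c \<Longrightarrow> z $$ (k, l) = (if k = l then 1 else 0)"
      by blast
    from act_invariant_clear_column [OF inv z(1) c zc z(3)]
    show ?case using z(2) by (metis less_Suc_eq_le)
  qed
  from this [of n] obtain y where y: "y \<in> SL n" "f y = f x"
    "\<forall>k<n. \<forall>l<n. y $$ (k, l) = (if k = l then 1 else 0)" by auto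
  then have "y = 1\<^sub>m n"
    using SL_carrier [OF y(1)] by (intro eq_matI) auto
  then show ?thesis using y by simp
qed

section \<open>Pattern groups of unipotent matrices\<close>

definition unip :: "(nat \<times> nat) set \<Rightarrow> bit mat set" where
  "unip P = {g \<in> SL n. \<forall>i<n. \<forall>j<n. (i, j) \<notin> P \<longrightarrow> g $$ (i, j) = (if i = j then 1 else 0)}"

text \<open>If \<open>(i, j)\<close> is not in \<open>P\<close>, transitivity excludes that
  \<open>(i, m)\<close> and \<open>(m, j)\<close> both are, so an off-diagonal entry of one factor
  always meets a zero of the other.\<close>

lemma unip_mult:
  assumes "trans P" "irrefl P" "g \<in> unip P" "h \<in> unip P"
  shows "g * h \<in> unip P"
proof -
  have gh: "g \<in> SL n" "h \<in> SL n"
    and g: "\<And>i j. i < n \<Longrightarrow> j < n \<Longrightarrow> (i, j) \<notin> P \<Longrightarrow> g $$ (i, j) = (if i = j then 1 else 0)"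
    and h: "\<And>i j. i < n \<Longrightarrow> j < n \<Longrightarrow> (i, j) \<notin> P \<Longrightarrow> h $$ (i, j) = (if i = j then 1 else 0)"
    using assms(3,4) by (auto simp: unip_def)
  have "(g * h) $$ (i, j) = (if i = j then 1 else 0)" if ij: "i < n" "j < n" "(i, j) \<notin> P" for i j
  proof -
    have "(g * h) $$ (i, j) = (\<Sum>m = 0..<n. g $$ (i, m) * h $$ (m, j))"
      using ij SL_carrier [OF gh(1)] SL_carrier [OF gh(2)] by (simp add: scalar_prod_def)
    also have "\<dots> = (\<Sum>m = 0..<n. if i = m then if i = j then 1 else 0 else 0)"
    proof (intro sum.cong refl)
      fix m assume "m \<in> {0..<n}"
      then have m: "m < n" by simp
      have irr: "(a, a) \<notin> P" for a using assms(2) by (simp add: irrefl_def)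
      show "g $$ (i, m) * h $$ (m, j) = (if i = m then if i = j then 1 else 0 else 0)"
      proof (cases "(i, m) \<in> P")
        case True
        then have "(m, j) \<notin> P" "m \<noteq> j" "i \<noteq> m"
          using assms(1) ij irr by (auto dest: transD)
        then show ?thesis using h [OF m ij(2)] by simp
      next
        case False
        then show ?thesis using g [OF ij(1) m] h [OF ij(1,2,3)] by auto
      qed
    qed
    finally show ?thesis using ij by simp
  qed
  then show ?thesis using gh by (simp add: unip_def SL_mult)
qed

lemma T_unip: "(i, j) \<in> pairs \<Longrightarrow> (i, j) \<in> P \<Longrightarrow> T (i, j) \<in> unip P"
  using T_SL [of "(i, j)"] by (auto simp: unip_def T_index pairs_def)

lemma one_unip: "1\<^sub>m n \<in> unip P"
  by (auto simp: unip_def SL_one)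

end

subsection \<open>Dirichlet forms\<close>

text \<open>The form (1 - a)(1 - c) + (1 - b)(1 - c) + 2 (1 - a)(1 - b) - (1 - c)^2 / 12, summed
  over an orbit of the dihedral group of order 8 with centre \<open>c\<close>. The first square
  belongs to the character that is -1 on both generators, the other four to the part odd under
  \<open>c\<close>. There the first three terms have least eigenvalue 6 - 4 sqrt 2 and (1 - c)^2 is
  4; the constant 1 / 12 lies just below (6 - 4 sqrt 2) / 4.\<close>

lemma D4_sum_of_squares:
  fixes v0 va vb vab vba vaba vbab vc :: real
  defines "F \<equiv> \<lambda>x a b c. (x - a) * (x - c) + (x - b) * (x - c) + 2 * (x - a) * (x - b) - (x - c)\<^sup>2 / 12"
  shows "0 \<le> F v0 va vb vc + F va v0 vba vbab + F vb vab v0 vaba + F vab vb vbab vba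
    + F vba vaba va vab + F vaba vba vc vb + F vbab vc vab va + F vc vbab vaba v0" (is "0 \<le> ?S")
proof -
  have "?S = ((v0 + vc) - (va + vbab) - (vb + vaba) + (vab + vba))\<^sup>2
    + 2 / 3 * ((3 / 2 * (v0 - vc) - (va - vbab) - (vb - vaba))\<^sup>2
      + (3 / 2 * (va - vbab) - (v0 - vc) + (vab - vba))\<^sup>2
      + (3 / 2 * (vb - vaba) - (vab - vba) - (v0 - vc))\<^sup>2
      + (3 / 2 * (vab - vba) - (vb - vaba) + (va - vbab))\<^sup>2)"
    unfolding F_def by (simp add: field_simps power2_eq_square)
  then show ?thesis by simp
qed

lemma square_sum5_le:
  fixes a b c d e :: real
  shows "(a + b + c + d + e)\<^sup>2 \<le> 5 * (a\<^sup>2 + b\<^sup>2 + c\<^sup>2 + d\<^sup>2 + e\<^sup>2)"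
proof -
  have "5 * (a\<^sup>2 + b\<^sup>2 + c\<^sup>2 + d\<^sup>2 + e\<^sup>2) - (a + b + c + d + e)\<^sup>2
    = (a - b)\<^sup>2 + (a - c)\<^sup>2 + (a - d)\<^sup>2 + (a - e)\<^sup>2 + (b - c)\<^sup>2 + (b - d)\<^sup>2 + (b - e)\<^sup>2
      + (c - d)\<^sup>2 + (c - e)\<^sup>2 + (d - e)\<^sup>2"
    by (simp add: field_simps power2_eq_square)
  also have "\<dots> \<ge> 0" by simp
  finally show ?thesis by simp
qed

context transvections
begin

definition dif :: "(bit mat \<Rightarrow> real) \<Rightarrow> nat \<times> nat \<Rightarrow> bit mat \<Rightarrow> real" where
  "dif f p x = f x - f (act p x)"

text \<open>The inner product of (1 - p) f and (1 - q) f; summed over all \<open>p\<close> and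
  \<open>q\<close> it is the squared norm of D f.\<close>

definition B :: "(bit mat \<Rightarrow> real) \<Rightarrow> nat \<times> nat \<Rightarrow> nat \<times> nat \<Rightarrow> real" where
  "B f p q = (\<Sum>x\<in>SL n. dif f p x * dif f q x)"

lemma finite_pairs [simp]: "finite pairs"
  by (rule finite_subset [of _ "{..<n} \<times> {..<n}"]) (auto simp: pairs_def)

lemma card_pairs: "real (card pairs) = real n * (real n - 1)"
proof -
  have "pairs = Sigma {..<n} (\<lambda>i. {..<n} - {i})" by (auto simp: pairs_def)
  then have "card pairs = n * (n - 1)" by (simp add: card_SigmaI)
  then show ?thesis using n3 by (simp add: of_nat_diff)
qed

lemma B_commute: "B f p q = B f q p"
  by (simp add: B_def mult.commute)

lemma B_self_nonneg: "0 \<le> B f p p"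
  by (simp add: B_def sum_nonneg)

text \<open>An involution \<open>s\<close> satisfies (1 - s)^2 = 2 (1 - s), so the diagonal terms
  are twice the Dirichlet form.\<close>

lemma B_self_eq: "p \<in> pairs \<Longrightarrow> B f p p = 2 * (\<Sum>x\<in>SL n. f x * dif f p x)"
proof -
  assume p: "p \<in> pairs"
  have "B f p p = (\<Sum>x\<in>SL n. f x * dif f p x) - (\<Sum>x\<in>SL n. f (act p x) * dif f p x)"
    by (simp add: B_def dif_def [of f p] sum_subtractf [symmetric] left_diff_distrib)
  also have "(\<Sum>x\<in>SL n. f (act p x) * dif f p x) = (\<Sum>x\<in>SL n. f (act p (act p x)) * dif f p (act p x))"
    by (rule sum_act [OF p, symmetric])
  also have "\<dots> = (\<Sum>x\<in>SL n. - (f x * dif f p x))"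
    using p by (intro sum.cong refl) (simp add: dif_def act_act SL_carrier algebra_simps)
  finally show ?thesis by (simp add: sum_negf)
qed

text \<open>Summing the product of differences over the four images of \<open>x\<close> under the
  two commuting involutions gives a perfect square.\<close>

lemma B_commuting_nonneg:
  assumes p: "p \<in> pairs" and q: "q \<in> pairs"
    and comm: "\<And>x. x \<in> SL n \<Longrightarrow> act p (act q x) = act q (act p x)"
  shows "0 \<le> B f p q"
proof -
  let ?F = "\<lambda>x. dif f p x * dif f q x"
  have "(\<Sum>x\<in>SL n. ?F (act p x)) = B f p q" "(\<Sum>x\<in>SL n. ?F (act q x)) = B f p q"
    "(\<Sum>x\<in>SL n. ?F (act q (act p x))) = B f p q"
    using sum_act [OF p, of ?F] sum_act [OF q, of ?F] sum_act [OF p, of "\<lambda>x. ?F (act q x)"]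
    by (simp_all add: B_def)
  then have "4 * B f p q = (\<Sum>x\<in>SL n. ?F x + ?F (act p x) + ?F (act q x) + ?F (act q (act p x)))"
    by (simp add: sum.distrib B_def)
  also have "\<dots> = (\<Sum>x\<in>SL n. (f x - f (act p x) - f (act q x) + f (act q (act p x)))\<^sup>2)"
  proof (intro sum.cong refl)
    fix x assume x: "x \<in> SL n"
    have "act p (act q (act p x)) = act q x"
      using comm [OF act_SL [OF p x]] act_act [OF SL_carrier [OF x] p] by simp
    then show "?F x + ?F (act p x) + ?F (act q x) + ?F (act q (act p x))
      = (f x - f (act p x) - f (act q x) + f (act q (act p x)))\<^sup>2"
      using x p q by (simp add: dif_def act_act comm act_SL SL_carrier power2_eq_square algebra_simps)
  qed
  also have "\<dots> \<ge> 0" by (intro sum_nonneg) simp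
  finally show ?thesis by simp
qed

text \<open>Both inequalities live on orbits of the dihedral group generated by the transvections
  (i, j) and (j, k). The first follows from \<open>D4_sum_of_squares\<close> by averaging over the
  group, the second from the relation a b a b = c, a closed walk of odd length.\<close>

lemma
  assumes ijk: "i < n" "j < n" "k < n" "i \<noteq> j" "j \<noteq> k" "i \<noteq> k"
  shows B_triple: "B f (i, k) (i, k) / 12
      \<le> B f (i, j) (i, k) + B f (j, k) (i, k) + 2 * B f (i, j) (j, k)"
    and sum_triple: "2 / 5 * (\<Sum>x\<in>SL n. (f x)\<^sup>2) \<le> (\<Sum>x\<in>SL n. (f x + f (act (i, j) x))\<^sup>2)
      + (\<Sum>x\<in>SL n. (f x + f (act (j, k) x))\<^sup>2) + (\<Sum>x\<in>SL n. (f x + f (act (i, k) x))\<^sup>2)"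
proof -
  define a where "a = act (i, j)"
  define b where "b = act (j, k)"
  define c where "c = act (i, k)"
  have p: "(i, j) \<in> pairs" "(j, k) \<in> pairs" "(i, k) \<in> pairs"
    using ijk by (auto simp: pairs_def)
  have S: "a x \<in> SL n" "b x \<in> SL n" "c x \<in> SL n" if "x \<in> SL n" for x
    using that p by (simp_all add: a_def b_def c_def act_SL)
  have inv: "a (a x) = x" "b (b x) = x" "c (c x) = x" if "x \<in> SL n" for x
    using that p by (simp_all add: a_def b_def c_def act_act SL_carrier)
  have c: "a (b (a (b x))) = c x" if "x \<in> SL n" for x
    unfolding a_def b_def c_def using ijk that by (simp add: act_commutator SL_carrier)
  have comm: "c (a x) = a (c x)" "c (b x) = b (c x)" if "x \<in> SL n" for x
    unfolding a_def b_def c_def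
    using act_commute [OF SL_carrier [OF that] p(3,1)] act_commute [OF SL_carrier [OF that] p(3,2)] ijk by auto
  \<comment> \<open>The relations from here on reduce every word that will occur to one of the eight
    elements 1, a, b, ab, ba, aba, bab and c.\<close>
  have c': "b (a (b (a x))) = c x" if x: "x \<in> SL n" for x
  proof -
    have "b (a (b (a (c (c x))))) = b (a (b (a (a (b (a (b (c x))))))))"
      using x by (simp only: c [symmetric] S)
    also have "\<dots> = c x"
      using x by (simp only: inv S)
    finally show ?thesis using x by (simp only: inv)
  qed
  have ca: "c (a x) = b (a (b x))" if x: "x \<in> SL n" for x
  proof -
    have "c (a x) = a (a (b (a (b x))))" using x by (simp only: comm c)
    then show ?thesis using x by (simp only: inv S)
  qed
  have cb: "c (b x) = a (b (a x))" if x: "x \<in> SL n" for x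
  proof -
    have "c (b x) = b (b (a (b (a x))))" using x by (simp only: comm c')
    then show ?thesis using x by (simp only: inv S)
  qed
  have cab: "c (a (b x)) = b (a x)" if x: "x \<in> SL n" for x
    using ca [OF S(2) [OF x]] x by (simp only: inv S)
  have cba: "c (b (a x)) = a (b x)" if x: "x \<in> SL n" for x
    using cb [OF S(1) [OF x]] x by (simp only: inv S)
  have caba: "c (a (b (a x))) = b x" if x: "x \<in> SL n" for x
    using cab [OF S(1) [OF x]] x by (simp only: inv S)
  have cbab: "c (b (a (b x))) = a x" if x: "x \<in> SL n" for x
    using cba [OF S(2) [OF x]] x by (simp only: inv S)
  have ac: "a (c x) = b (a (b x))" "b (c x) = a (b (a x))" if x: "x \<in> SL n" for x
    using comm [OF x] ca [OF x] cb [OF x] by simp_all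
  have sa: "(\<Sum>x\<in>SL n. F (a x)) = (\<Sum>x\<in>SL n. F x)"
    and sb: "(\<Sum>x\<in>SL n. F (b x)) = (\<Sum>x\<in>SL n. F x)"
    and sc: "(\<Sum>x\<in>SL n. F (c x)) = (\<Sum>x\<in>SL n. F x)" for F :: "bit mat \<Rightarrow> real"
    using p by (simp_all add: a_def b_def c_def sum_act)
  have sab: "(\<Sum>x\<in>SL n. F (a (b x))) = (\<Sum>x\<in>SL n. F x)"
    and sba: "(\<Sum>x\<in>SL n. F (b (a x))) = (\<Sum>x\<in>SL n. F x)" for F :: "bit mat \<Rightarrow> real"
    using sb [of "\<lambda>x. F (a x)"] sa [of "\<lambda>x. F (b x)"] sa [of F] sb [of F] by simp_all
  have saba: "(\<Sum>x\<in>SL n. F (a (b (a x)))) = (\<Sum>x\<in>SL n. F x)"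
    and sbab: "(\<Sum>x\<in>SL n. F (b (a (b x)))) = (\<Sum>x\<in>SL n. F x)" for F :: "bit mat \<Rightarrow> real"
    using sa [of "\<lambda>x. F (a (b x))"] sb [of "\<lambda>x. F (b (a x))"] sab [of F] sba [of F] by simp_all
  let ?G = "\<lambda>x a b c. (x - a) * (x - c) + (x - b) * (x - c) + 2 * (x - a) * (x - b) - (x - c)\<^sup>2 / 12"
  define F where "F x = ?G (f x) (f (a x)) (f (b x)) (f (c x))" for x
  have "8 * (\<Sum>x\<in>SL n. F x) = (\<Sum>x\<in>SL n. F x + F (a x) + F (b x) + F (a (b x)) + F (b (a x))
      + F (a (b (a x))) + F (b (a (b x))) + F (c x))"
    by (simp add: sum.distrib sa sb sc sab sba saba sbab)
  also have "\<dots> \<ge> 0"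
  proof (rule sum_nonneg)
    fix x assume x: "x \<in> SL n"
    \<comment> \<open>Each line lists the values at one point of the orbit and at its images under
      \<open>a\<close>, \<open>b\<close> and \<open>c\<close>.\<close>
    have "F x + F (a x) + F (b x) + F (a (b x)) + F (b (a x)) + F (a (b (a x))) + F (b (a (b x))) + F (c x)
      = ?G (f x) (f (a x)) (f (b x)) (f (c x))
      + ?G (f (a x)) (f x) (f (b (a x))) (f (b (a (b x))))
      + ?G (f (b x)) (f (a (b x))) (f x) (f (a (b (a x))))
      + ?G (f (a (b x))) (f (b x)) (f (b (a (b x)))) (f (b (a x)))
      + ?G (f (b (a x))) (f (a (b (a x)))) (f (a x)) (f (a (b x)))
      + ?G (f (a (b (a x)))) (f (b (a x))) (f (c x)) (f (b x))
      + ?G (f (b (a (b x)))) (f (c x)) (f (a (b x))) (f (a x))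
      + ?G (f (c x)) (f (b (a (b x)))) (f (a (b (a x)))) (f x)"
      unfolding F_def using x by (simp only: S inv c c' ca cb cab cba caba cbab ac)
    also have "\<dots> \<ge> 0"
      by (rule D4_sum_of_squares)
    finally show "0 \<le> F x + F (a x) + F (b x) + F (a (b x)) + F (b (a x)) + F (a (b (a x)))
      + F (b (a (b x))) + F (c x)" .
  qed
  finally have "0 \<le> (\<Sum>x\<in>SL n. F x)" by simp
  also have "(\<Sum>x\<in>SL n. F x) = (\<Sum>x\<in>SL n. dif f (i, j) x * dif f (i, k) x + dif f (j, k) x * dif f (i, k) x
      + 2 * (dif f (i, j) x * dif f (j, k) x) - dif f (i, k) x * dif f (i, k) x / 12)"
    by (simp only: F_def dif_def a_def b_def c_def power2_eq_square mult.assoc)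
  also have "\<dots> = B f (i, j) (i, k) + B f (j, k) (i, k) + 2 * B f (i, j) (j, k)
      - B f (i, k) (i, k) / 12"
    by (simp only: B_def sum.distrib sum_subtractf sum_distrib_left sum_divide_distrib)
  finally show "B f (i, k) (i, k) / 12 \<le> B f (i, j) (i, k) + B f (j, k) (i, k) + 2 * B f (i, j) (j, k)"
    by simp
  let ?ha = "\<lambda>x. f x + f (a x)" and ?hb = "\<lambda>x. f x + f (b x)" and ?hc = "\<lambda>x. f x + f (c x)"
  have "(\<Sum>x\<in>SL n. 4 * (f x)\<^sup>2) \<le> (\<Sum>x\<in>SL n. 5 * ((?hc x)\<^sup>2 + (?ha (b (a (b x))))\<^sup>2
      + (?hb (a (b x)))\<^sup>2 + (?ha (b x))\<^sup>2 + (?hb x)\<^sup>2))"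
  proof (rule sum_mono)
    fix x assume x: "x \<in> SL n"
    \<comment> \<open>The walk x, bx, abx, babx, ababx = cx, x has five edges. With alternating
      signs its edge sums telescope except at \<open>x\<close>, which is counted twice because the
      length is odd.\<close>
    have "2 * f x = ?hc x + (- ?ha (b (a (b x)))) + ?hb (a (b x)) + (- ?ha (b x)) + ?hb x"
      using x by (simp add: c)
    then have "(2 * f x)\<^sup>2 \<le> 5 * ((?hc x)\<^sup>2 + (- ?ha (b (a (b x))))\<^sup>2
      + (?hb (a (b x)))\<^sup>2 + (- ?ha (b x))\<^sup>2 + (?hb x)\<^sup>2)"
      by (simp only: square_sum5_le)
    then show "4 * (f x)\<^sup>2 \<le> 5 * ((?hc x)\<^sup>2 + (?ha (b (a (b x))))\<^sup>2
      + (?hb (a (b x)))\<^sup>2 + (?ha (b x))\<^sup>2 + (?hb x)\<^sup>2)"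
      by (simp only: power2_minus power_mult_distrib) simp
  qed
  also have "\<dots> = 5 * ((\<Sum>x\<in>SL n. (?hc x)\<^sup>2) + 2 * (\<Sum>x\<in>SL n. (?ha x)\<^sup>2) + 2 * (\<Sum>x\<in>SL n. (?hb x)\<^sup>2))"
    using sbab [of "\<lambda>x. (?ha x)\<^sup>2"] sab [of "\<lambda>x. (?hb x)\<^sup>2"] sb [of "\<lambda>x. (?ha x)\<^sup>2"]
    by (simp only: sum.distrib sum_distrib_left [symmetric]) (simp only: mult_2 add_ac)
  finally have "4 * (\<Sum>x\<in>SL n. (f x)\<^sup>2) \<le> 5 * ((\<Sum>x\<in>SL n. (?hc x)\<^sup>2) + 2 * (\<Sum>x\<in>SL n. (?ha x)\<^sup>2)
      + 2 * (\<Sum>x\<in>SL n. (?hb x)\<^sup>2))"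
    by (simp only: sum_distrib_left [symmetric])
  moreover have "0 \<le> (\<Sum>x\<in>SL n. (?hc x)\<^sup>2)" by (intro sum_nonneg) simp
  \<comment> \<open>The walk uses \<open>a\<close> and \<open>b\<close> twice but \<open>c\<close>
    once; counting \<open>c\<close> twice as well gives 4 u \<le> 10 (r + s + t).\<close>
  moreover have "2 / 5 * u \<le> r + s + t" if "4 * u \<le> 5 * (t + 2 * r + 2 * s)" "0 \<le> t" for r s t u :: real
    using that by argo
  ultimately have "2 / 5 * (\<Sum>x\<in>SL n. (f x)\<^sup>2)
    \<le> (\<Sum>x\<in>SL n. (?ha x)\<^sup>2) + (\<Sum>x\<in>SL n. (?hb x)\<^sup>2) + (\<Sum>x\<in>SL n. (?hc x)\<^sup>2)"
    by blast
  then show "2 / 5 * (\<Sum>x\<in>SL n. (f x)\<^sup>2) \<le> (\<Sum>x\<in>SL n. (f x + f (act (i, j) x))\<^sup>2)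
      + (\<Sum>x\<in>SL n. (f x + f (act (j, k) x))\<^sup>2) + (\<Sum>x\<in>SL n. (f x + f (act (i, k) x))\<^sup>2)"
    by (simp only: a_def b_def c_def)
qed

section \<open>Summation over triples: spectral gap and upper end of the spectrum\<close>

definition triples :: "(nat \<times> nat \<times> nat) set" where
  "triples = {(i, j, k). i < n \<and> j < n \<and> k < n \<and> i \<noteq> j \<and> j \<noteq> k \<and> i \<noteq> k}"

lemma sum_triples:
  "(\<Sum>(i, j, k)\<in>triples. G i j k) = (\<Sum>(i, j)\<in>pairs. \<Sum>k\<in>{..<n} - {i, j}. G i j (k::nat) :: real)"
proof -
  have "(\<Sum>(i, j)\<in>pairs. \<Sum>k\<in>{..<n} - {i, j}. G i j k)
      = (\<Sum>p\<in>pairs. \<Sum>k\<in>{..<n} - {fst p, snd p}. G (fst p) (snd p) k)"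
    by (simp add: split_def)
  also have "\<dots> = (\<Sum>(p, k)\<in>Sigma pairs (\<lambda>p. {..<n} - {fst p, snd p}). G (fst p) (snd p) k)"
    by (rule sum.Sigma) auto
  also have "\<dots> = (\<Sum>(i, j, k)\<in>triples. G i j k)"
    by (rule sum.reindex_bij_witness [of _ "\<lambda>(i, j, k). ((i, j), k)" "\<lambda>((i, j), k). (i, j, k)"])
      (auto simp: triples_def pairs_def)
  finally show ?thesis by simp
qed

text \<open>Every pair extends to a triple in n - 2 ways, the source of the factor of order n in the
  gap.\<close>

lemma sum_triples_pair: "(\<Sum>(i, j, k)\<in>triples. G i j) = (real n - 2) * (\<Sum>(i, j)\<in>pairs. G i j)"
proof -
  have "(\<Sum>k\<in>{..<n} - {i, j}. c) = (real n - 2) * c" if "(i, j) \<in> pairs" for i j and c :: real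
  proof -
    have "card ({..<n} - {i, j}) = n - 2" using that by (simp add: pairs_def card_Diff_subset)
    then show ?thesis using n3 by (simp add: of_nat_diff)
  qed
  then show ?thesis
    unfolding sum_triples sum_distrib_left by (intro sum.cong refl) auto
qed

lemma sum_triples_rotate: "(\<Sum>(i, j, k)\<in>triples. G i j k) = (\<Sum>(i, j, k)\<in>triples. G j k i)"
  by (rule sum.reindex_bij_witness [of _ "\<lambda>(i, j, k). (j, k, i)" "\<lambda>(i, j, k). (k, i, j)"])
    (auto simp: triples_def)

lemma sum_triples_swap: "(\<Sum>(i, j, k)\<in>triples. G i j k) = (\<Sum>(i, j, k)\<in>triples. G i k j)"
  by (rule sum.reindex_bij_witness [of _ "\<lambda>(i, j, k). (i, k, j)" "\<lambda>(i, j, k). (i, k, j)"])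
    (auto simp: triples_def)

text \<open>Pairs are sorted by their position relative to \<open>(i, j)\<close>: equal, opposite,
  sharing one index in one of four ways, or disjoint from it. The last kind is dropped.\<close>

lemma sum_pairs_ge:
  fixes G :: "nat \<times> nat \<Rightarrow> real"
  assumes p: "(i, j) \<in> pairs"
    and nn: "\<And>k l. (k, l) \<in> pairs \<Longrightarrow> k \<noteq> j \<Longrightarrow> l \<noteq> i \<Longrightarrow> k \<noteq> i \<Longrightarrow> l \<noteq> j \<Longrightarrow> 0 \<le> G (k, l)"
  shows "G (i, j) + G (j, i) + (\<Sum>k\<in>{..<n} - {i, j}. G (i, k) + G (k, j) + G (j, k) + G (k, i))
    \<le> (\<Sum>q\<in>pairs. G q)"
proof -
  let ?R = "{..<n} - {i, j}"
  let ?A = "Pair i ` ?R" and ?B = "(\<lambda>k. (k, j)) ` ?R" and ?C = "Pair j ` ?R" and ?D = "(\<lambda>k. (k, i)) ` ?R"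
  have ij: "i \<noteq> j" "i < n" "j < n" using p by (auto simp: pairs_def)
  have im: "(\<Sum>q\<in>?A. G q) = (\<Sum>k\<in>?R. G (i, k))" "(\<Sum>q\<in>?B. G q) = (\<Sum>k\<in>?R. G (k, j))"
    "(\<Sum>q\<in>?C. G q) = (\<Sum>k\<in>?R. G (j, k))" "(\<Sum>q\<in>?D. G q) = (\<Sum>k\<in>?R. G (k, i))"
    by (subst sum.reindex; simp add: inj_on_def)+
  have 1: "sum G (?A \<union> ?B) = sum G ?A + sum G ?B"
    by (rule sum.union_disjoint) auto
  have 2: "sum G (?A \<union> ?B \<union> ?C) = sum G (?A \<union> ?B) + sum G ?C"
    by (rule sum.union_disjoint) (use ij in auto)
  have 3: "sum G (?A \<union> ?B \<union> ?C \<union> ?D) = sum G (?A \<union> ?B \<union> ?C) + sum G ?D"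
    by (rule sum.union_disjoint) (use ij in auto)
  have 4: "sum G ({(i, j), (j, i)} \<union> (?A \<union> ?B \<union> ?C \<union> ?D)) = sum G {(i, j), (j, i)} + sum G (?A \<union> ?B \<union> ?C \<union> ?D)"
    by (rule sum.union_disjoint) auto
  have "sum G {(i, j), (j, i)} = G (i, j) + G (j, i)" using ij by simp
  then have "G (i, j) + G (j, i) + (\<Sum>k\<in>?R. G (i, k) + G (k, j) + G (j, k) + G (k, i))
    = sum G ({(i, j), (j, i)} \<union> (?A \<union> ?B \<union> ?C \<union> ?D))"
    unfolding 4 3 2 1 im sum.distrib by simp
  also have "\<dots> \<le> sum G pairs"
  proof (rule sum_mono2)
    show "{(i, j), (j, i)} \<union> (?A \<union> ?B \<union> ?C \<union> ?D) \<subseteq> pairs" using ij by (auto simp: pairs_def)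
    fix q assume q: "q \<in> pairs - ({(i, j), (j, i)} \<union> (?A \<union> ?B \<union> ?C \<union> ?D))"
    obtain k l where kl: "q = (k, l)" by force
    have "(k, l) \<in> pairs" "k \<noteq> j \<and> l \<noteq> i \<and> k \<noteq> i \<and> l \<noteq> j"
      using q by (auto simp: kl pairs_def)
    then show "0 \<le> G q" using nn kl by simp
  qed simp
  finally show ?thesis .
qed

text \<open>The right side is the squared norm of D f, and the sum on the left is twice the
  Dirichlet form, so this reads D^2 \<ge> (n - 2) / 6 D.\<close>

theorem transvection_gap:
  "(real n - 2) / 12 * (\<Sum>p\<in>pairs. B f p p) \<le> (\<Sum>x\<in>SL n. (\<Sum>p\<in>pairs. dif f p x)\<^sup>2)"
proof -
  have "(\<Sum>x\<in>SL n. (\<Sum>p\<in>pairs. dif f p x)\<^sup>2) = (\<Sum>x\<in>SL n. \<Sum>p\<in>pairs. \<Sum>q\<in>pairs. dif f p x * dif f q x)"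
    by (simp add: power2_eq_square sum_product)
  also have "\<dots> = (\<Sum>p\<in>pairs. \<Sum>x\<in>SL n. \<Sum>q\<in>pairs. dif f p x * dif f q x)"
    by (rule sum.swap)
  also have "\<dots> = (\<Sum>p\<in>pairs. \<Sum>q\<in>pairs. B f p q)"
    unfolding B_def by (intro sum.cong refl sum.swap)
  finally have eq: "(\<Sum>x\<in>SL n. (\<Sum>p\<in>pairs. dif f p x)\<^sup>2) = (\<Sum>p\<in>pairs. \<Sum>q\<in>pairs. B f p q)" .
  let ?H = "\<lambda>i j k. B f (i, j) (i, k) + B f (i, j) (k, j) + B f (i, j) (j, k) + B f (i, j) (k, i)"
  have "(\<Sum>(i, j)\<in>pairs. B f (i, j) (i, j) + B f (i, j) (j, i) + (\<Sum>k\<in>{..<n} - {i, j}. ?H i j k))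
    \<le> (\<Sum>(i, j)\<in>pairs. \<Sum>q\<in>pairs. B f (i, j) q)"
  proof (intro sum_mono, clarify)
    fix i j assume p: "(i, j) \<in> pairs"
    show "B f (i, j) (i, j) + B f (i, j) (j, i) + (\<Sum>k\<in>{..<n} - {i, j}. ?H i j k) \<le> (\<Sum>q\<in>pairs. B f (i, j) q)"
    proof (rule sum_pairs_ge [OF p, of "B f (i, j)"])
      fix k l assume "(k, l) \<in> pairs" "k \<noteq> j" "l \<noteq> i"
      then show "0 \<le> B f (i, j) (k, l)"
        using p by (intro B_commuting_nonneg act_commute SL_carrier) auto
    qed
  qed
  also have "(\<Sum>(i, j)\<in>pairs. \<Sum>q\<in>pairs. B f (i, j) q) = (\<Sum>p\<in>pairs. \<Sum>q\<in>pairs. B f p q)"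
    by (simp add: split_def)
  also have "(\<Sum>(i, j)\<in>pairs. B f (i, j) (i, j) + B f (i, j) (j, i) + (\<Sum>k\<in>{..<n} - {i, j}. ?H i j k))
    = (\<Sum>(i, j)\<in>pairs. B f (i, j) (i, j) + B f (i, j) (j, i)) + (\<Sum>(i, j, k)\<in>triples. ?H i j k)"
    unfolding sum_triples by (simp only: split_def sum.distrib)
  finally have main: "(\<Sum>(i, j)\<in>pairs. B f (i, j) (i, j) + B f (i, j) (j, i)) + (\<Sum>(i, j, k)\<in>triples. ?H i j k)
    \<le> (\<Sum>p\<in>pairs. \<Sum>q\<in>pairs. B f p q)" .
  \<comment> \<open>Diagonal and opposite pairs together are half the sum of the squared norms of
    \<open>dif f (i, j) + dif f (j, i)\<close>.\<close>
  have opp: "0 \<le> (\<Sum>(i, j)\<in>pairs. B f (i, j) (i, j) + B f (i, j) (j, i))"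
  proof -
    have swap: "(\<Sum>(i, j)\<in>pairs. B f (j, i) (j, i)) = (\<Sum>(i, j)\<in>pairs. B f (i, j) (i, j))"
      by (rule sum.reindex_bij_witness [of _ "\<lambda>(i, j). (j, i)" "\<lambda>(i, j). (j, i)"])
        (auto simp: pairs_def)
    have "0 \<le> (\<Sum>(i, j)\<in>pairs. \<Sum>x\<in>SL n. (dif f (i, j) x + dif f (j, i) x)\<^sup>2)"
      by (intro sum_nonneg) (auto intro: sum_nonneg)
    also have "\<dots> = (\<Sum>(i, j)\<in>pairs. B f (i, j) (i, j) + B f (j, i) (j, i) + 2 * B f (i, j) (j, i))"
      by (intro sum.cong refl)
        (auto simp: B_def sum.distrib [symmetric] sum_distrib_left power2_eq_square algebra_simps
          intro!: sum.cong)
    also have "\<dots> = 2 * (\<Sum>(i, j)\<in>pairs. B f (i, j) (i, j) + B f (i, j) (j, i))"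
      using swap by (simp add: split_def sum.distrib sum_distrib_left)
    finally show ?thesis by simp
  qed
  \<comment> \<open>Relabelling the triples gathers the four kinds of neighbouring pairs into the
    right side of \<open>B_triple\<close>, always with (i, k) as the central pair.\<close>
  have "(\<Sum>(i, j, k)\<in>triples. ?H i j k) = (\<Sum>(i, j, k)\<in>triples. B f (i, j) (i, k))
      + (\<Sum>(i, j, k)\<in>triples. B f (i, j) (k, j)) + (\<Sum>(i, j, k)\<in>triples. B f (i, j) (j, k))
      + (\<Sum>(i, j, k)\<in>triples. B f (i, j) (k, i))"
    by (simp add: split_def sum.distrib)
  also have "(\<Sum>(i, j, k)\<in>triples. B f (i, j) (k, j)) = (\<Sum>(i, j, k)\<in>triples. B f (j, k) (i, k))"
    by (rule sum_triples_rotate)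
  also have "(\<Sum>(i, j, k)\<in>triples. B f (i, j) (k, i)) = (\<Sum>(i, j, k)\<in>triples. B f (i, j) (j, k))"
    by (subst sum_triples_rotate) (simp add: B_commute)
  finally have H: "(\<Sum>(i, j, k)\<in>triples. ?H i j k)
      = (\<Sum>(i, j, k)\<in>triples. B f (i, j) (i, k) + B f (j, k) (i, k) + 2 * B f (i, j) (j, k))"
    by (simp add: split_def sum.distrib sum_distrib_left)
  have "(real n - 2) / 12 * (\<Sum>p\<in>pairs. B f p p) = (\<Sum>(i, j, k)\<in>triples. B f (i, j) (i, j) / 12)"
    by (subst sum_triples_pair) (simp add: split_def sum_divide_distrib [symmetric])
  also have "\<dots> = (\<Sum>(i, j, k)\<in>triples. B f (i, k) (i, k) / 12)"
    by (rule sum_triples_swap)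
  also have "\<dots> \<le> (\<Sum>(i, j, k)\<in>triples. ?H i j k)"
    unfolding H by (intro sum_mono, clarify, rule B_triple) (auto simp: triples_def)
  also have "\<dots> \<le> (\<Sum>p\<in>pairs. \<Sum>q\<in>pairs. B f p q)"
    using main opp by linarith
  finally show ?thesis unfolding eq .
qed

text \<open>By the parallelogram law, \<open>B f p p\<close> is 4 times the squared norm of
  \<open>f\<close> minus the squared norm of f + p f. \<open>sum_triple\<close> bounds the latter
  from below on average, and as each triple involves three pairs, 2 / 5 becomes 2 / 15.\<close>

theorem transvection_top:
  "(\<Sum>p\<in>pairs. B f p p) \<le> (4 - 2 / 15) * real (card pairs) * (\<Sum>x\<in>SL n. (f x)\<^sup>2)"
proof -
  let ?f = "\<Sum>x\<in>SL n. (f x)\<^sup>2"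
  let ?h = "\<lambda>i j. \<Sum>x\<in>SL n. (f x + f (act (i, j) x))\<^sup>2"
  have h: "?h i j = 4 * ?f - B f (i, j) (i, j)" if p: "(i, j) \<in> pairs" for i j
  proof -
    have "?h i j + B f (i, j) (i, j) = 2 * ?f + 2 * (\<Sum>x\<in>SL n. (f (act (i, j) x))\<^sup>2)"
      unfolding B_def sum.distrib [symmetric] sum_distrib_left
      by (intro sum.cong refl) (simp add: dif_def power2_eq_square algebra_simps)
    also have "(\<Sum>x\<in>SL n. (f (act (i, j) x))\<^sup>2) = ?f"
      by (rule sum_act [OF p])
    finally show ?thesis by simp
  qed
  have pos: "0 < real n - 2" using n3 by simp
  have "(real n - 2) * (real (card pairs) * (2 / 5 * ?f)) = (\<Sum>(i, j, k)\<in>triples. 2 / 5 * ?f)"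
    by (subst sum_triples_pair) (simp add: split_def)
  also have "\<dots> \<le> (\<Sum>(i, j, k)\<in>triples. ?h i j + ?h j k + ?h i k)"
    by (intro sum_mono, clarify, rule sum_triple) (auto simp: triples_def)
  also have "\<dots> = (\<Sum>(i, j, k)\<in>triples. ?h i j) + (\<Sum>(i, j, k)\<in>triples. ?h j k) + (\<Sum>(i, j, k)\<in>triples. ?h i k)"
    by (simp add: split_def sum.distrib)
  also have "(\<Sum>(i, j, k)\<in>triples. ?h j k) = (\<Sum>(i, j, k)\<in>triples. ?h i j)"
    by (rule sum_triples_rotate [symmetric])
  also have "(\<Sum>(i, j, k)\<in>triples. ?h i k) = (\<Sum>(i, j, k)\<in>triples. ?h i j)"
    by (rule sum_triples_swap)
  also have "(\<Sum>(i, j, k)\<in>triples. ?h i j) = (real n - 2) * (\<Sum>(i, j)\<in>pairs. ?h i j)"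
    by (rule sum_triples_pair)
  also have "(\<Sum>(i, j)\<in>pairs. ?h i j) = (\<Sum>(i, j)\<in>pairs. 4 * ?f - B f (i, j) (i, j))"
    by (intro sum.cong refl) (auto simp: h)
  also have "\<dots> = real (card pairs) * (4 * ?f) - (\<Sum>p\<in>pairs. B f p p)"
    by (simp add: split_def sum_subtractf)
  finally have "(real n - 2) * (real (card pairs) * (2 / 5 * ?f))
    \<le> (real n - 2) * (3 * (real (card pairs) * (4 * ?f) - (\<Sum>p\<in>pairs. B f p p)))"
    by (simp add: algebra_simps)
  then have "real (card pairs) * (2 / 5 * ?f) \<le> 3 * (real (card pairs) * (4 * ?f) - (\<Sum>p\<in>pairs. B f p p))"
    using pos by (simp only: mult_le_cancel_left_pos)
  then show ?thesis by (simp add: algebra_simps)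
qed

end

subsection \<open>Heat kernels\<close>

sublocale transvections \<subseteq> finite_index "SL n"
  by standard (rule finite_SL)

context transvections
begin

text \<open>For all pairs this is D = N (1 - P). The guard \<open>x \<in> SL n\<close> makes the
  kernel symmetric on the whole type, as the equation \<open>tp (lap P) = lap P\<close>
  demands.\<close>

definition lap :: "(nat \<times> nat) set \<Rightarrow> bit mat \<Rightarrow> bit mat \<Rightarrow> real" where
  "lap P x y = (\<Sum>p\<in>P. one x y - (if x \<in> SL n \<and> y = act p x then 1 else 0))"

text \<open>Generators act from the left, so right translations are symmetries of all kernels built
  from them. Such a kernel has a constant diagonal, which turns traces into return values.\<close>

definition rinv :: "(bit mat \<Rightarrow> bit mat \<Rightarrow> real) \<Rightarrow> bool" where
  "rinv K \<longleftrightarrow> (\<forall>x\<in>SL n. \<forall>y\<in>SL n. \<forall>h\<in>SL n. K (x * h) (y * h) = K x y)"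

definition supported :: "bit mat set \<Rightarrow> (bit mat \<Rightarrow> bit mat \<Rightarrow> real) \<Rightarrow> bool" where
  "supported \<Gamma> K \<longleftrightarrow> (\<forall>x\<in>SL n. \<forall>y\<in>SL n. K x y \<noteq> 0 \<longrightarrow> (\<exists>g\<in>\<Gamma>. y = g * x))"

text \<open>In the finite group \<open>SL n\<close> these are exactly the subgroups.\<close>

definition submonoid :: "bit mat set \<Rightarrow> bool" where
  "submonoid \<Gamma> \<longleftrightarrow> \<Gamma> \<subseteq> SL n \<and> 1\<^sub>m n \<in> \<Gamma> \<and> (\<forall>g\<in>\<Gamma>. \<forall>h\<in>\<Gamma>. g * h \<in> \<Gamma>)"

definition heat :: "real \<Rightarrow> (nat \<times> nat) set \<Rightarrow> bit mat \<Rightarrow> bit mat \<Rightarrow> real" where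
  "heat r P = expk (\<lambda>x y. - r * lap P x y)"

text \<open>For r \<ge> 0, the probability that the continuous-time walk which applies each
  transvection of \<open>P\<close> at rate 1 is back at its start at time \<open>r\<close>.\<close>

definition return :: "real \<Rightarrow> (nat \<times> nat) set \<Rightarrow> real" where
  "return r P = heat r P (1\<^sub>m n) (1\<^sub>m n)"

lemma one_mult_left [simp]: "x \<in> SL n \<Longrightarrow> 1\<^sub>m n * x = x"
  by (rule left_mult_one_mat [OF SL_carrier])

lemma card_SL_pos: "0 < card (SL n)"
  using SL_one finite_SL by (auto simp: card_gt_0_iff)

lemma tp_lap:
  assumes "P \<subseteq> pairs"
  shows "tp (lap P) = lap P"
  unfolding tp_eq_iff lap_def
proof (intro allI sum.cong refl)
  fix x y p assume "p \<in> P"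
  then have "x \<in> SL n \<and> y = act p x \<longleftrightarrow> y \<in> SL n \<and> x = act p y"
    using assms by (metis act_SL act_act SL_carrier subsetD)
  moreover have "one x y = one y x" by (auto simp: one_def)
  ultimately show "one x y - (if x \<in> SL n \<and> y = act p x then 1 else 0)
      = one y x - (if y \<in> SL n \<and> x = act p y then 1 else 0)"
    by simp
qed

lemma app_lap:
  assumes "P \<subseteq> pairs" "x \<in> SL n"
  shows "app (lap P) f x = (\<Sum>p\<in>P. dif f p x)"
proof -
  have "app (lap P) f x = (\<Sum>y\<in>SL n. \<Sum>p\<in>P. (one x y - (if y = act p x then 1 else 0)) * f y)"
    using assms by (simp add: app_def lap_def sum_distrib_right)
  also have "\<dots> = (\<Sum>p\<in>P. \<Sum>y\<in>SL n. (if y = x then f y else 0) - (if y = act p x then f y else 0))"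
    by (subst sum.swap) (intro sum.cong refl, simp add: one_def)
  also have "\<dots> = (\<Sum>p\<in>P. dif f p x)"
    using assms by (intro sum.cong refl) (auto simp: sum_subtractf dif_def act_SL)
  finally show ?thesis .
qed

lemma mult_right_cancel:
  assumes "x \<in> SL n" "y \<in> SL n" "h \<in> SL n"
  shows "x * h = y * h \<longleftrightarrow> x = y"
  using bij_betw_mult_right [OF assms(3)] assms(1,2) by (auto simp: bij_betw_def inj_on_def)

lemma rinv_one: "rinv one"
  by (simp add: rinv_def one_def mult_right_cancel)

lemma rinv_lap: "P \<subseteq> pairs \<Longrightarrow> rinv (lap P)"
  unfolding rinv_def lap_def
  by (intro ballI sum.cong refl)
    (auto simp: one_def mult_right_cancel SL_mult act_mult_right act_SL subset_iff)

lemma rinv_mm: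
  assumes "rinv K" "rinv L"
  shows "rinv (mm K L)"
  unfolding rinv_def
proof (intro ballI)
  fix x y h assume xyh: "x \<in> SL n" "y \<in> SL n" "h \<in> SL n"
  have "mm K L (x * h) (y * h) = (\<Sum>z\<in>SL n. K (x * h) (z * h) * L (z * h) (y * h))"
    unfolding mm_def by (rule sum.reindex_bij_betw [OF bij_betw_mult_right [OF xyh(3)], symmetric])
  also have "\<dots> = mm K L x y"
    using assms xyh unfolding mm_def rinv_def by (intro sum.cong refl) auto
  finally show "mm K L (x * h) (y * h) = mm K L x y" .
qed

lemma rinv_pp: "rinv K \<Longrightarrow> rinv (pp K m)"
  by (induction m) (simp_all add: rinv_mm)

lemma rinv_euler: "rinv A \<Longrightarrow> rinv (euler A m)"
  using rinv_one by (simp add: rinv_def euler_def)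

lemma rinv_expk: "rinv A \<Longrightarrow> rinv (expk A)"
  using rinv_pp [OF rinv_euler] by (simp add: rinv_def expk_def)

lemma rinv_heat: "P \<subseteq> pairs \<Longrightarrow> rinv (heat r P)"
  unfolding heat_def by (rule rinv_expk) (use rinv_lap in \<open>simp add: rinv_def\<close>)

lemma rinv_diag:
  assumes "rinv K" "x \<in> SL n"
  shows "K x x = K (1\<^sub>m n) (1\<^sub>m n)"
proof -
  have "K (1\<^sub>m n * x) (1\<^sub>m n * x) = K (1\<^sub>m n) (1\<^sub>m n)"
    using assms SL_one unfolding rinv_def by blast
  then show ?thesis using assms(2) by simp
qed

lemma tr_rinv: "rinv K \<Longrightarrow> tr K = real (card (SL n)) * K (1\<^sub>m n) (1\<^sub>m n)"
  by (simp add: tr_def rinv_diag)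

lemma supported_mm:
  assumes "submonoid \<Gamma>" "supported \<Gamma> K" "supported \<Gamma> L"
  shows "supported \<Gamma> (mm K L)"
  unfolding supported_def
proof (intro ballI impI)
  fix x y assume xy: "x \<in> SL n" "y \<in> SL n" and "mm K L x y \<noteq> 0"
  then have "\<not> (\<forall>z\<in>SL n. K x z * L z y = 0)"
    unfolding mm_def using sum.neutral [of "SL n" "\<lambda>z. K x z * L z y"] by blast
  then obtain z where z: "z \<in> SL n" "K x z \<noteq> 0" "L z y \<noteq> 0"
    by auto
  then obtain g h where gh: "g \<in> \<Gamma>" "z = g * x" "h \<in> \<Gamma>" "y = h * z"
    using assms(2,3) xy unfolding supported_def by blast
  moreover have "h * (g * x) = (h * g) * x"
    using gh(1,3) assms(1) xy by (intro SL_assoc [symmetric]) (auto simp: submonoid_def)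
  ultimately have "h * g \<in> \<Gamma>" "y = (h * g) * x"
    using assms(1) by (simp_all add: submonoid_def)
  then show "\<exists>g\<in>\<Gamma>. y = g * x" by blast
qed

lemma supported_pp: "submonoid \<Gamma> \<Longrightarrow> supported \<Gamma> K \<Longrightarrow> supported \<Gamma> (pp K m)"
  by (induction m) (simp_all add: supported_mm)

lemma supported_euler:
  assumes "submonoid \<Gamma>" "supported \<Gamma> A"
  shows "supported \<Gamma> (euler A m)"
  unfolding supported_def
proof (intro ballI impI)
  fix x y assume xy: "x \<in> SL n" "y \<in> SL n" "euler A m x y \<noteq> 0"
  then have "x = y \<or> A x y \<noteq> 0" by (auto simp: euler_def one_def)
  then show "\<exists>g\<in>\<Gamma>. y = g * x"
  proof
    assume "x = y"
    then have "y = 1\<^sub>m n * x" using xy by simp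
    then show ?thesis using assms(1) unfolding submonoid_def by blast
  next
    assume "A x y \<noteq> 0"
    then show ?thesis using assms(2) xy unfolding supported_def by blast
  qed
qed

lemma supported_expk:
  assumes "submonoid \<Gamma>" "supported \<Gamma> A"
  shows "supported \<Gamma> (expk A)"
  unfolding supported_def
proof (intro ballI impI)
  fix x y assume xy: "x \<in> SL n" "y \<in> SL n" "expk A x y \<noteq> 0"
  have "\<exists>m. pp (euler A m) m x y \<noteq> 0"
  proof (rule ccontr)
    assume "\<not> ?thesis"
    then have "expk A x y = lim (\<lambda>m. 0)" by (simp add: expk_def)
    then show False using xy(3) by simp
  qed
  then show "\<exists>g\<in>\<Gamma>. y = g * x"
    using supported_pp [OF assms(1) supported_euler [OF assms]] xy(1,2) unfolding supported_def by blast
qed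

lemma supported_heat:
  assumes "submonoid \<Gamma>" "T ` P \<subseteq> \<Gamma>"
  shows "supported \<Gamma> (heat r P)"
  unfolding heat_def
proof (rule supported_expk [OF assms(1)], unfold supported_def, intro ballI impI)
  fix x y assume xy: "x \<in> SL n" "y \<in> SL n" "- r * lap P x y \<noteq> 0"
  then have "lap P x y \<noteq> 0" by simp
  then have "\<not> (\<forall>p\<in>P. one x y - (if x \<in> SL n \<and> y = act p x then 1 else 0) = 0)"
    unfolding lap_def
    using sum.neutral [of P "\<lambda>p. one x y - (if x \<in> SL n \<and> y = act p x then 1 else 0)"] by blast
  then obtain p where p: "p \<in> P" "one x y - (if x \<in> SL n \<and> y = act p x then 1 else 0) \<noteq> 0"
    by blast
  then have "y = 1\<^sub>m n * x \<or> y = T p * x"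
    using xy by (auto simp: one_def act_def split: if_splits)
  then show "\<exists>g\<in>\<Gamma>. y = g * x"
    using assms p(1) unfolding submonoid_def by blast
qed

subsection \<open>Return probabilities\<close>

lemma return_nonneg: "P \<subseteq> pairs \<Longrightarrow> 0 \<le> return r P"
  unfolding return_def heat_def
  by (rule expk_diag_nonneg [OF _ SL_one]) (use tp_lap in \<open>simp add: tp_eq_iff\<close>)

text \<open>Golden-Thompson compares with the product of the two heat kernels, which returns only if
  both factors do.\<close>

lemma return_union:
  assumes P: "P \<subseteq> pairs" and Q: "Q \<subseteq> pairs" and disj: "P \<inter> Q = {}"
    and G: "submonoid \<Gamma>" "T ` P \<subseteq> \<Gamma>" and D: "submonoid \<Delta>" "T ` Q \<subseteq> \<Delta>"
    and triv: "\<And>g h. g \<in> \<Gamma> \<Longrightarrow> h \<in> \<Delta> \<Longrightarrow> h * g = 1\<^sub>m n \<Longrightarrow> g = 1\<^sub>m n"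
  shows "return r (P \<union> Q) \<le> return r P * return r Q"
proof -
  have fin: "finite P" "finite Q" using P Q finite_pairs by (blast intro: finite_subset)+
  have "lap (P \<union> Q) x y = lap P x y + lap Q x y" for x y
    unfolding lap_def using fin disj by (simp add: sum.union_disjoint)
  then have "heat r (P \<union> Q) = expk (\<lambda>x y. - r * lap P x y + - r * lap Q x y)"
    unfolding heat_def by (simp add: distrib_left)
  then have "tr (heat r (P \<union> Q)) \<le> tr (mm (heat r P) (heat r Q))"
    using Golden_Thompson [of "\<lambda>x y. - r * lap P x y" "\<lambda>x y. - r * lap Q x y"] tp_lap [OF P] tp_lap [OF Q]
    by (simp add: heat_def tp_eq_iff)
  also have "mm (heat r P) (heat r Q) x x = return r P * return r Q" if x: "x \<in> SL n" for x
  proof -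
    \<comment> \<open>A nonzero term is a loop x, g x, h g x = x. Then h g = 1, and
      \<open>triv\<close> leaves only the term z = x.\<close>
    have "heat r P x z * heat r Q z x = 0" if z: "z \<in> SL n" "z \<noteq> x" for z
    proof (rule ccontr)
      assume "heat r P x z * heat r Q z x \<noteq> 0"
      then obtain g h where gh: "g \<in> \<Gamma>" "z = g * x" "h \<in> \<Delta>" "x = h * z"
        using supported_heat [OF G] supported_heat [OF D] x z(1) unfolding supported_def
        by (metis mult_zero_left mult_zero_right)
      have S: "g \<in> SL n" "h \<in> SL n" using gh G(1) D(1) by (auto simp: submonoid_def)
      have "(h * g) * x = 1\<^sub>m n * x" using gh S x by (simp add: SL_assoc)
      then have "h * g = 1\<^sub>m n" using mult_right_cancel [of "h * g" "1\<^sub>m n" x] S x SL_mult SL_one by blast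
      then have "g = 1\<^sub>m n" using triv gh by blast
      then show False using gh(2) z(2) x by simp
    qed
    then have "mm (heat r P) (heat r Q) x x = (\<Sum>z\<in>SL n. if z = x then heat r P x x * heat r Q x x else 0)"
      unfolding mm_def by (intro sum.cong refl) auto
    also have "\<dots> = heat r P x x * heat r Q x x" using x by simp
    finally show ?thesis
      using rinv_diag [OF rinv_heat [OF P] x] rinv_diag [OF rinv_heat [OF Q] x] by (simp add: return_def)
  qed
  then have "tr (mm (heat r P) (heat r Q)) = real (card (SL n)) * (return r P * return r Q)"
    by (simp add: tr_def)
  also have "tr (heat r (P \<union> Q)) = real (card (SL n)) * return r (P \<union> Q)"
    unfolding return_def using P Q by (intro tr_rinv rinv_heat) simp
  finally show ?thesis using card_SL_pos by simp
qed

lemma return_empty: "return r {} = 1"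
proof -
  have "pp one m x y = one x y" if "x \<in> SL n" "y \<in> SL n" for m x y
    using that
  proof (induction m arbitrary: x y)
    case (Suc m)
    then have "pp one (Suc m) x y = (\<Sum>z\<in>SL n. one x z * one z y)"
      by (simp add: mm_def)
    also have "\<dots> = one x y"
      using Suc.prems by (simp add: one_def if_distrib [of "\<lambda>t. t * _"] cong: if_cong)
    finally show ?case .
  qed simp
  moreover have "euler (\<lambda>x y. 0) m = one" for m by (simp add: euler_def)
  ultimately show ?thesis
    using SL_one [of n] by (simp add: return_def heat_def lap_def expk_def) (simp add: one_def)
qed

text \<open>The Laplacian \<open>L\<close> of an involution satisfies \<open>L\<^sup>2 = 2 L\<close>.\<close>

lemma return_single:
  assumes p: "p \<in> pairs"
  shows "return r {p} = (1 + exp (- 2 * r)) / 2"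
proof -
  let ?L = "lap {p}"
  have P: "{p} \<subseteq> pairs" using p by simp
  have L: "?L x y = one x y - one (act p x) y" if "x \<in> SL n" for x y
    using that by (auto simp: lap_def one_def)
  have mmL: "mm ?L K x y = K x y - K (act p x) y" if "x \<in> SL n" for K x y
    using app_lap [OF P that, of "\<lambda>z. K z y"] by (simp add: app_def mm_def dif_def)
  \<comment> \<open>Since L has the eigenvalues 0 and 2, the kernel 1 - (1 - a) / 2 L has the
    eigenvalues 1 and \<open>a\<close>, and taking a power only replaces \<open>a\<close> by its
    power.\<close>
  have pw: "pp (\<lambda>x y. one x y - (1 - a) / 2 * ?L x y) m x y = one x y - (1 - a ^ (2 ^ m)) / 2 * ?L x y"
    if "x \<in> SL n" "y \<in> SL n" for a m x y
    using that
  proof (induction m arbitrary: x y)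
    case (Suc m)
    define b where "b = (1 - a ^ (2 ^ m)) / 2"
    let ?K = "\<lambda>x y. one x y - b * ?L x y"
    have x: "act p x \<in> SL n" and xx: "act p (act p x) = x"
      using Suc.prems p by (simp_all add: act_SL act_act SL_carrier)
    have "pp (\<lambda>x y. one x y - (1 - a) / 2 * ?L x y) (Suc m) x y = mm ?K ?K x y"
      unfolding pp.simps mm_def using Suc by (intro sum.cong refl) (simp add: b_def)
    also have "\<dots> = (\<Sum>z\<in>SL n. one x z * ?K z y - b * (?L x z * ?K z y))"
      unfolding mm_def by (intro sum.cong refl) (simp add: algebra_simps)
    also have "\<dots> = ?K x y - b * mm ?L ?K x y"
      using Suc.prems
      by (simp add: sum_subtractf mm_def sum_distrib_left one_def if_distrib [of "\<lambda>t. t * _"] cong: if_cong)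
    also have "\<dots> = one x y - (2 * b - 2 * b\<^sup>2) * ?L x y"
      using Suc.prems(1) x by (simp add: mmL L xx power2_eq_square algebra_simps)
    also have "2 * b - 2 * b\<^sup>2 = (1 - a ^ (2 ^ Suc m)) / 2"
      by (simp add: b_def power2_eq_square field_simps power_mult)
    finally show ?case .
  qed simp
  have "act p (1\<^sub>m n) \<noteq> 1\<^sub>m n"
  proof
    assume eq: "act p (1\<^sub>m n) = 1\<^sub>m n"
    obtain i j where ij: "p = (i, j)" by force
    then have "act (i, j) (1\<^sub>m n) $$ (i, j) = 1\<^sub>m n $$ (i, j)" using eq by simp
    then show False using p ij by (simp add: pairs_def act_index)
  qed
  then have L1: "?L (1\<^sub>m n) (1\<^sub>m n) = 1"
    using SL_one by (simp add: L) (simp add: one_def)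
  \<comment> \<open>The Euler step is the kernel above with a = 1 - 2 r / 2 ^ m.\<close>
  have "euler (\<lambda>x y. - r * ?L x y) m = (\<lambda>x y. one x y - (1 - (1 + (- 2 * r) / 2 ^ m)) / 2 * ?L x y)" for m
    by (simp add: euler_def fun_eq_iff)
  then have "pp (euler (\<lambda>x y. - r * ?L x y) m) m (1\<^sub>m n) (1\<^sub>m n) = (1 + (1 + (- 2 * r) / 2 ^ m) ^ (2 ^ m)) / 2" for m
    by (simp only: pw [OF SL_one SL_one] L1) (simp add: one_def field_simps)
  moreover have "(\<lambda>m. (1 + (1 + (- 2 * r) / 2 ^ m) ^ (2 ^ m)) / 2) \<longlonglongrightarrow> (1 + exp (- 2 * r)) / 2"
    by (intro tendsto_intros tendsto_power_two_exp) simp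
  ultimately show ?thesis
    unfolding return_def heat_def expk_def by (simp only: limI)
qed

section \<open>Return probabilities on unipotent groups\<close>

lemma T_image_unip: "P \<subseteq> pairs \<Longrightarrow> T ` P \<subseteq> unip P"
  using T_unip by force

lemma submonoid_unip: "trans P \<Longrightarrow> irrefl P \<Longrightarrow> submonoid (unip P)"
  unfolding submonoid_def using unip_mult one_unip by (auto simp: unip_def)

lemma submonoid_involution:
  assumes "p \<in> pairs"
  shows "submonoid {1\<^sub>m n, T p}"
proof -
  have "T p * T p = act p (act p (1\<^sub>m n))"
    by (simp add: act_def right_mult_one_mat [OF T_carrier])
  then have "T p * T p = 1\<^sub>m n" using assms by (simp add: act_act)
  then show ?thesis
    using T_SL [OF assms] SL_one by (auto simp: submonoid_def right_mult_one_mat [OF T_carrier])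
qed

text \<open>A pair with the fewest intermediate points has none: an intermediate \<open>m\<close>
  would give \<open>(i, m)\<close> strictly fewer. Such a covering pair is not a composite of two
  others, so its removal keeps transitivity.\<close>

lemma trans_remove_cover:
  assumes "finite P" "P \<noteq> {}" "trans P" "irrefl P"
  obtains i j where "(i, j) \<in> P" "trans (P - {(i, j)})"
proof -
  let ?b = "\<lambda>p. {m. (fst p, m) \<in> P \<and> (m, snd p) \<in> P}"
  have fin: "finite (?b p)" for p
    by (rule finite_subset [of _ "snd ` P"]) (use assms(1) in force)+
  obtain p where p: "p \<in> P" "\<And>q. q \<in> P \<Longrightarrow> card (?b p) \<le> card (?b q)"
    using ex_has_least_nat [of "\<lambda>p. p \<in> P" _ "\<lambda>p. card (?b p)"] assms(2) by blast
  obtain i j where ij: "p = (i, j)" by force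
  have none: False if m: "(i, m) \<in> P" "(m, j) \<in> P" for m
  proof -
    have "m \<notin> ?b (i, m)" using assms(4) by (simp add: irrefl_def)
    moreover have "?b (i, m) \<subseteq> ?b p" "m \<in> ?b p"
      using m assms(3) by (auto simp: ij dest: transD)
    ultimately have "?b (i, m) \<subset> ?b p" by blast
    then have "card (?b (i, m)) < card (?b p)" using fin by (simp add: psubset_card_mono)
    then show False using p(2) [OF m(1)] by simp
  qed
  have "trans (P - {(i, j)})"
    using none assms(3) unfolding trans_def by blast
  then show ?thesis using that p(1) ij by blast
qed

text \<open>Covering pairs are removed one by one. The remaining pattern group has a 0 in position
  (i, j) and therefore does not contain \<open>T (i, j)\<close>, so \<open>return_union\<close>
  applies and each pair contributes the factor of a single bit.\<close>

lemma return_unipotent: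
  assumes "P \<subseteq> pairs" "trans P" "irrefl P"
  shows "return r P \<le> ((1 + exp (- 2 * r)) / 2) ^ card P"
  using assms
proof (induction "card P" arbitrary: P)
  case 0
  then have "P = {}" using finite_subset [OF 0(2) finite_pairs] by simp
  then show ?case by (simp add: return_empty)
next
  case (Suc c)
  have fin: "finite P" "P \<noteq> {}"
    using finite_subset [OF Suc.prems(1) finite_pairs] Suc.hyps(2) by auto
  obtain i j where ij: "(i, j) \<in> P" and tr: "trans (P - {(i, j)})"
    using trans_remove_cover [OF fin Suc.prems(2,3)] by blast
  let ?P = "P - {(i, j)}"
  have p: "(i, j) \<in> pairs" using ij Suc.prems by blast
  have irr: "irrefl ?P" using Suc.prems(3) by (simp add: irrefl_def)
  have c: "c = card ?P" using Suc.hyps(2) fin ij by simp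
  have "return r (?P \<union> {(i, j)}) \<le> return r ?P * return r {(i, j)}"
  proof (rule return_union [where \<Gamma> = "unip ?P" and \<Delta> = "{1\<^sub>m n, T (i, j)}"])
    show "T ` ?P \<subseteq> unip ?P" using Suc.prems(1) by (intro T_image_unip) blast
    fix g h assume g: "g \<in> unip ?P" and h: "h \<in> {1\<^sub>m n, T (i, j)}" and hg: "h * g = 1\<^sub>m n"
    have gS: "g \<in> SL n" using g by (simp add: unip_def)
    show "g = 1\<^sub>m n"
    proof (cases "h = 1\<^sub>m n")
      case True
      then show ?thesis using hg gS by simp
    next
      case False
      then have "act (i, j) g = 1\<^sub>m n" using h hg by (auto simp: act_def)
      then have "g = act (i, j) (1\<^sub>m n)" using act_act [OF SL_carrier [OF gS] p] by simp
      then have "g = T (i, j)" by (simp add: act_def right_mult_one_mat [OF T_carrier])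
      moreover have "g $$ (i, j) = 0" using g p by (simp add: unip_def pairs_def)
      ultimately show ?thesis using p by (simp add: T_index pairs_def)
    qed
  qed (use Suc.prems p tr irr submonoid_unip submonoid_involution in auto)
  also have "\<dots> \<le> ((1 + exp (- 2 * r)) / 2) ^ c * ((1 + exp (- 2 * r)) / 2)"
    unfolding return_single [OF p] c
  proof (rule mult_right_mono)
    show "return r ?P \<le> ((1 + exp (- 2 * r)) / 2) ^ card ?P"
      using Suc.prems(1) by (intro Suc.hyps(1) c tr irr) auto
    show "0 \<le> (1 + exp (- 2 * r)) / 2" by (simp add: add_nonneg_nonneg)
  qed
  also have "\<dots> = ((1 + exp (- 2 * r)) / 2) ^ card P"
    using Suc.hyps(2) by (simp flip: Suc.hyps(2))
  finally show ?case using ij by (simp add: insert_absorb)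
qed

text \<open>The upper and the lower unitriangular group meet trivially. By induction on the row,
  entry (i, j) of \<open>h * g\<close> reduces to that of \<open>g\<close>: terms with m < i vanish
  by induction, those with m > i because \<open>h\<close> is lower triangular.\<close>

lemma upper_lower_trivial:
  assumes g: "g \<in> unip {(i, j) \<in> pairs. i < j}" and h: "h \<in> unip {(i, j) \<in> pairs. j < i}"
    and hg: "h * g = 1\<^sub>m n"
  shows "g = 1\<^sub>m n"
proof -
  have S: "g \<in> SL n" "h \<in> SL n" using g h by (auto simp: unip_def)
  have g1: "g $$ (i, j) = (if i = j then 1 else 0)" if "i < n" "j < n" "j \<le> i" for i j
    using g that by (simp add: unip_def)
  have h1: "h $$ (i, j) = (if i = j then 1 else 0)" if "i < n" "j < n" "i \<le> j" for i j
    using h that by (simp add: unip_def)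
  have up: "g $$ (i, j) = 0" if "i < j" "j < n" for i j
    using that
  proof (induction i arbitrary: j rule: less_induct)
    case (less i)
    have "(\<Sum>m = 0..<n. h $$ (i, m) * g $$ (m, j)) = (\<Sum>m = 0..<n. if m = i then g $$ (i, j) else 0)"
    proof (intro sum.cong refl)
      fix m assume "m \<in> {0..<n}"
      then show "h $$ (i, m) * g $$ (m, j) = (if m = i then g $$ (i, j) else 0)"
        using less h1 [of i m] by (cases m i rule: linorder_cases) auto
    qed
    moreover have "(\<Sum>m = 0..<n. h $$ (i, m) * g $$ (m, j)) = (h * g) $$ (i, j)"
      using less.prems SL_carrier [OF S(1)] SL_carrier [OF S(2)] by (simp add: scalar_prod_def)
    ultimately show ?case using less.prems hg by simp
  qed
  show ?thesis
  proof (rule eq_matI)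
    fix i j assume "i < dim_row (1\<^sub>m n)" "j < dim_col (1\<^sub>m n)"
    then show "g $$ (i, j) = 1\<^sub>m n $$ (i, j)"
      using g1 up by (cases "i < j") auto
  qed (use SL_carrier [OF S(1)] in auto)
qed

theorem return_pairs: "return r pairs \<le> ((1 + exp (- 2 * r)) / 2) ^ card pairs"
proof -
  let ?U = "{(i, j) \<in> pairs. i < j}" and ?L = "{(i, j) \<in> pairs. j < i}"
  let ?q = "(1 + exp (- 2 * r)) / 2"
  have UL: "pairs = ?U \<union> ?L" by (auto simp: pairs_def)
  have tU: "trans ?U" "irrefl ?U" and tL: "trans ?L" "irrefl ?L"
    by (auto simp: trans_def irrefl_def pairs_def)
  have "return r (?U \<union> ?L) \<le> return r ?U * return r ?L"
  proof (rule return_union [where \<Gamma> = "unip ?U" and \<Delta> = "unip ?L"])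
    show "T ` ?U \<subseteq> unip ?U" "T ` ?L \<subseteq> unip ?L" by (auto intro!: T_image_unip)
    show "g = 1\<^sub>m n" if "g \<in> unip ?U" "h \<in> unip ?L" "h * g = 1\<^sub>m n" for g h
      using that by (rule upper_lower_trivial)
  qed (use tU tL submonoid_unip in auto)
  also have "\<dots> \<le> ?q ^ card ?U * ?q ^ card ?L"
  proof (rule mult_mono)
    show "return r ?U \<le> ?q ^ card ?U" by (rule return_unipotent [OF _ tU]) auto
    show "return r ?L \<le> ?q ^ card ?L" by (rule return_unipotent [OF _ tL]) auto
    show "0 \<le> return r ?L" by (rule return_nonneg) auto
    show "0 \<le> ?q ^ card ?U" by (intro zero_le_power) (simp add: add_nonneg_nonneg)
  qed
  also have "\<dots> = ?q ^ card (?U \<union> ?L)"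
    by (subst card_Un_disjoint) (auto simp: power_add intro: finite_subset [OF _ finite_pairs])
  finally show ?thesis using UL by simp
qed

end

section \<open>Eigenvalues of the Laplacian\<close>

lemma (in finite_index) eigenbasis_scale:
  assumes "eigenbasis A d u l"
  shows "eigenbasis (\<lambda>x y. c * A x y) d u (\<lambda>i. c * l i)"
proof -
  have "app (\<lambda>x y. c * A x y) f x = c * app A f x" for f x
    by (simp add: app_def sum_distrib_left mult.assoc)
  then show ?thesis
    using assms by (simp add: eigenbasis_def eigenfamily_def)
qed

context transvections
begin

text \<open>The sum is the trace of the heat kernel, whose diagonal is constant by right invariance
  and bounded by \<open>return_pairs\<close>.\<close>

lemma heat_trace:
  assumes E: "eigenbasis (lap pairs) d u l"
  shows "(\<Sum>i<d. exp (- r * l i)) \<le> real (card (SL n)) * ((1 + exp (- 2 * r)) / 2) ^ card pairs"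
proof -
  have "(\<Sum>i<d. exp (- r * l i)) = tr (heat r pairs)"
    unfolding heat_def
    by (rule eigenbasis_tr [OF eigenbasis_scale [OF E], symmetric])
      (rule expk_spectral [OF eigenbasis_scale [OF E]])
  also have "\<dots> = real (card (SL n)) * return r pairs"
    unfolding return_def by (intro tr_rinv rinv_heat) simp
  also have "\<dots> \<le> real (card (SL n)) * ((1 + exp (- 2 * r)) / 2) ^ card pairs"
    by (intro mult_left_mono return_pairs) simp
  finally show ?thesis .
qed

lemma eigenvalue_form:
  assumes E: "eigenbasis (lap pairs) d u l" and i: "i < d"
  shows "(\<Sum>p\<in>pairs. B (u i) p p) = 2 * l i"
    and "(\<Sum>x\<in>SL n. (u i x)\<^sup>2) = 1"
    and "(\<Sum>x\<in>SL n. (\<Sum>p\<in>pairs. dif (u i) p x)\<^sup>2) = (l i)\<^sup>2"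
proof -
  have ev: "(\<Sum>p\<in>pairs. dif (u i) p x) = l i * u i x" if "x \<in> SL n" for x
    using E i that app_lap [OF subset_refl that, of "u i"] by (simp add: eigenbasis_def eigenfamily_def)
  show n1: "(\<Sum>x\<in>SL n. (u i x)\<^sup>2) = 1"
    using E i by (simp add: eigenbasis_def eigenfamily_def ip_def power2_eq_square)
  have "(\<Sum>p\<in>pairs. B (u i) p p) = 2 * (\<Sum>p\<in>pairs. \<Sum>x\<in>SL n. u i x * dif (u i) p x)"
    by (simp add: B_self_eq sum_distrib_left)
  also have "(\<Sum>p\<in>pairs. \<Sum>x\<in>SL n. u i x * dif (u i) p x) = (\<Sum>x\<in>SL n. u i x * (\<Sum>p\<in>pairs. dif (u i) p x))"
    by (subst sum.swap) (simp add: sum_distrib_left)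
  also have "\<dots> = (\<Sum>x\<in>SL n. l i * (u i x)\<^sup>2)"
    by (intro sum.cong refl) (simp add: ev power2_eq_square)
  also have "\<dots> = l i"
    using n1 by (simp flip: sum_distrib_left)
  finally show "(\<Sum>p\<in>pairs. B (u i) p p) = 2 * l i" .
  have "(\<Sum>x\<in>SL n. (\<Sum>p\<in>pairs. dif (u i) p x)\<^sup>2) = (\<Sum>x\<in>SL n. (l i)\<^sup>2 * (u i x)\<^sup>2)"
    by (intro sum.cong refl) (simp add: ev power_mult_distrib)
  then show "(\<Sum>x\<in>SL n. (\<Sum>p\<in>pairs. dif (u i) p x)\<^sup>2) = (l i)\<^sup>2"
    using n1 by (simp flip: sum_distrib_left)
qed

text \<open>At a unit eigenvector the gap inequality becomes (n - 2) / 6 l \<le> l^2 with l \<ge> 0,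
  and \<open>transvection_top\<close> becomes the upper bound.\<close>

lemma eigenvalue_bounds:
  assumes E: "eigenbasis (lap pairs) d u l" and i: "i < d"
  shows "l i = 0 \<or> (real n - 2) / 6 \<le> l i" and "l i \<le> (2 - 1 / 15) * real (card pairs)"
proof -
  note form = eigenvalue_form [OF E i]
  have "0 \<le> 2 * l i"
    unfolding form(1) [symmetric] by (intro sum_nonneg B_self_nonneg)
  moreover have "(real n - 2) / 6 * l i \<le> l i * l i"
    using transvection_gap [of "u i"] unfolding form by (simp add: power2_eq_square mult.commute)
  ultimately show "l i = 0 \<or> (real n - 2) / 6 \<le> l i"
    using mult_right_le_imp_le [of "(real n - 2) / 6" "l i" "l i"] by fastforce
  show "l i \<le> (2 - 1 / 15) * real (card pairs)"
    using transvection_top [of "u i"] unfolding form by simp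
qed

text \<open>An eigenfunction for 0 has vanishing Dirichlet form, hence is invariant under all
  transvections and constant. Two constants are not orthonormal.\<close>

lemma eigenvalue_zero_unique:
  assumes E: "eigenbasis (lap pairs) d u l" and i: "i < d" "l i = 0" and j: "j < d" "l j = 0"
  shows "i = j"
proof (rule ccontr)
  assume "i \<noteq> j"
  have const: "u i x = u i (1\<^sub>m n)" if i: "i < d" "l i = 0" and x: "x \<in> SL n" for i x
  proof (rule act_invariant_constant [OF _ x])
    fix p x assume p: "p \<in> pairs" and x: "x \<in> SL n"
    have "B (u i) p p = 0"
      using eigenvalue_form(1) [OF E i(1)] i(2) p
      by (simp add: sum_nonneg_eq_0_iff B_self_nonneg)
    then have "dif (u i) p x = 0"
      using x finite_SL by (simp add: B_def sum_nonneg_eq_0_iff)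
    then show "u i (act p x) = u i x" by (simp add: dif_def)
  qed
  have ip: "ip (u a) (u b) = real (card (SL n)) * (u a (1\<^sub>m n) * u b (1\<^sub>m n))"
    if "a < d" "l a = 0" "b < d" "l b = 0" for a b
    unfolding ip_def using const that by simp
  have "ip (u i) (u i) = 1" "ip (u j) (u j) = 1" "ip (u i) (u j) = 0"
    using E i j \<open>i \<noteq> j\<close> by (auto simp: eigenbasis_def eigenfamily_def)
  then show False using ip i j by auto
qed

subsection \<open>The transition matrix\<close>

text \<open>P = 1 - D / N. The walk tests whether some generator leads from \<open>x\<close> to
  \<open>y\<close> while \<open>lap\<close> counts them; by \<open>act_inj\<close> there is at most
  one.\<close>

lemma walk_eq:
  assumes x: "x \<in> SL n"
  shows "transvection_walk n x y = one x y - lap pairs x y / real (card pairs)"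
proof -
  have walk: "transvection_walk n x y = (if \<exists>p\<in>pairs. y = act p x then 1 else 0) / real (card pairs)"
  proof -
    have "(\<exists>i<n. \<exists>j<n. i \<noteq> j \<and> y = (1\<^sub>m n + E n i j) * x) \<longleftrightarrow> (\<exists>p\<in>pairs. y = act p x)"
      by (auto simp: pairs_def act_def T_def)
    then show ?thesis unfolding transvection_walk_def card_pairs by simp
  qed
  have "(\<Sum>p\<in>pairs. if y = act p x then 1 else 0) = (if \<exists>p\<in>pairs. y = act p x then 1 else (0::real))"
  proof (cases "\<exists>p\<in>pairs. y = act p x")
    case True
    then obtain q where q: "q \<in> pairs" "y = act q x" by blast
    have "(\<Sum>p\<in>pairs. if y = act p x then 1 else 0) = (\<Sum>p\<in>pairs. if p = q then 1 else (0::real))"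
      using act_inj [OF x] q by (intro sum.cong refl) auto
    then show ?thesis using q True by simp
  qed (simp add: sum.neutral)
  moreover have "lap pairs x y = real (card pairs) * one x y - (\<Sum>p\<in>pairs. if y = act p x then 1 else 0)"
    using x by (simp add: lap_def sum_subtractf)
  moreover have "real (card pairs) \<noteq> 0" using n3 by (simp add: card_pairs)
  ultimately show ?thesis unfolding walk by (simp only: diff_divide_distrib) simp
qed

abbreviation walk_step :: "nat \<Rightarrow> bit mat \<Rightarrow> bit mat \<Rightarrow> real" where
  "walk_step \<equiv> step_matrix (SL n) (transvection_walk n)"

lemma walk_step_Suc: "walk_step (Suc t) = mm (walk_step t) (transvection_walk n)"
  by (simp add: mm_def)

lemma walk_step_spectral:
  assumes E: "eigenbasis (lap pairs) d u l" and xy: "x \<in> SL n" "y \<in> SL n"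
  shows "walk_step t x y = (\<Sum>i<d. (1 - l i / real (card pairs)) ^ t * u i x * u i y)"
  using xy
proof (induction t arbitrary: x y)
  case 0
  then show ?case using E by (simp add: eigenbasis_def one_def)
next
  case (Suc t)
  have "transvection_walk n x y = (\<Sum>i<d. (1 - l i / real (card pairs)) * u i x * u i y)"
    if "x \<in> SL n" "y \<in> SL n" for x y
    using eigenbasis_expand [OF E that] E that
    by (simp add: walk_eq eigenbasis_def left_diff_distrib sum_subtractf sum_divide_distrib)
  from eigenbasis_mm [OF E Suc.IH this Suc.prems] show ?case
    unfolding walk_step_Suc by (simp add: mult_ac)
qed

lemma rinv_walk_step: "rinv (walk_step t)"
proof (induction t)
  case 0
  then show ?case using rinv_one by (simp add: rinv_def one_def)
next
  case (Suc t)
  have "rinv (transvection_walk n)"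
    using rinv_one rinv_lap [OF subset_refl] by (simp add: rinv_def walk_eq SL_mult)
  with Suc show ?case unfolding walk_step_Suc by (rule rinv_mm)
qed

lemma walk_step_row_sum:
  assumes "x \<in> SL n"
  shows "(\<Sum>y\<in>SL n. walk_step t x y) = 1"
  using assms
proof (induction t)
  case 0
  then show ?case by simp
next
  case (Suc t)
  have row: "(\<Sum>y\<in>SL n. transvection_walk n z y) = 1" if z: "z \<in> SL n" for z
  proof -
    have "(\<Sum>y\<in>SL n. lap pairs z y) = 0"
      using app_lap [OF subset_refl z, of "\<lambda>x. 1"] by (simp add: app_def dif_def)
    then show ?thesis
      using z by (simp add: walk_eq sum_subtractf sum_divide_distrib [symmetric]) (simp add: one_def)
  qed
  have "(\<Sum>y\<in>SL n. walk_step (Suc t) x y) = (\<Sum>z\<in>SL n. \<Sum>y\<in>SL n. walk_step t x z * transvection_walk n z y)"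
    unfolding walk_step_Suc mm_def by (rule sum.swap)
  also have "\<dots> = (\<Sum>z\<in>SL n. walk_step t x z)"
    by (intro sum.cong refl) (simp add: row flip: sum_distrib_left)
  finally show ?case using Suc by simp
qed

text \<open>By right invariance all rows of P^t have the same squared norm, so a single row already
  gives the trace of P^t times its transpose. The row sums 1 account for the final -1.\<close>

lemma l2_norm_walk_step:
  assumes E: "eigenbasis (lap pairs) d u l" and x: "x \<in> SL n"
  shows "(l2_norm (SL n) (uniform (SL n)) (\<lambda>y. walk_step t x y / uniform (SL n) y - 1))\<^sup>2
    = (\<Sum>i<d. (1 - l i / real (card pairs)) ^ (2 * t)) - 1"
proof -
  let ?c = "real (card (SL n))" and ?K = "walk_step t" and ?a = "\<lambda>i. 1 - l i / real (card pairs)"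
  have c: "?c > 0" using card_SL_pos by simp
  have tp: "tp ?K x y = (\<Sum>i<d. ?a i ^ t * u i x * u i y)" if "x \<in> SL n" "y \<in> SL n" for x y
    using walk_step_spectral [OF E that(2,1)] by (simp add: tp_def mult_ac)
  let ?M = "mm ?K (tp ?K)"
  have M: "?M x y = (\<Sum>i<d. ?a i ^ (2 * t) * u i x * u i y)" if "x \<in> SL n" "y \<in> SL n" for x y
    using eigenbasis_mm [OF E walk_step_spectral [OF E] tp that] by (simp add: mult_2 power_add)
  have "rinv (tp ?K)" using rinv_walk_step by (auto simp: rinv_def tp_def)
  then have "rinv ?M" by (rule rinv_mm [OF rinv_walk_step])
  then have "?c * ?M x x = tr ?M" using rinv_diag [OF _ x] tr_rinv by metis
  also have "\<dots> = (\<Sum>i<d. ?a i ^ (2 * t))"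
    by (rule eigenbasis_tr [OF E]) (rule M)
  finally have sq: "?c * (\<Sum>y\<in>SL n. (?K x y)\<^sup>2) = (\<Sum>i<d. ?a i ^ (2 * t))"
    by (simp add: mm_def tp_def power2_eq_square)
  have "(l2_norm (SL n) (uniform (SL n)) (\<lambda>y. ?K x y / uniform (SL n) y - 1))\<^sup>2
    = (\<Sum>y\<in>SL n. (1 / ?c) * (?c * ?K x y - 1)\<^sup>2)"
    unfolding l2_norm_def
    by (subst real_sqrt_pow2) (auto intro!: sum_nonneg simp: uniform_def mult.commute)
  also have "\<dots> = (\<Sum>y\<in>SL n. ?c * (?K x y)\<^sup>2 - 2 * ?K x y + 1 / ?c)"
  proof (intro sum.cong refl)
    show "(1 / ?c) * (?c * ?K x y - 1)\<^sup>2 = ?c * (?K x y)\<^sup>2 - 2 * ?K x y + 1 / ?c" for y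
    proof -
      have "(1 / a) * (a * k - 1)\<^sup>2 = a * k\<^sup>2 - 2 * k + 1 / a" if "0 < a" for a k :: real
        using that by (simp add: field_simps power2_eq_square)
      then show ?thesis using c .
    qed
  qed
  also have "\<dots> = ?c * (\<Sum>y\<in>SL n. (?K x y)\<^sup>2) - 2 * (\<Sum>y\<in>SL n. ?K x y) + 1"
    using c by (simp add: sum.distrib sum_subtractf sum_distrib_left card_gt_0_iff)
  finally show ?thesis by (simp only: sq walk_step_row_sum [OF x])
qed

subsection \<open>The mixing time\<close>

text \<open>The eigenvalue 0 contributes at most the 1 that is subtracted. For 0 < l \<le> N the
  power is at most exp (- (r + s) l), where the part with \<open>r\<close> is kept for the heat
  trace and the part with \<open>s\<close> uses the gap. For l > N the base has modulus at most 14 /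
  15, hence at most exp (- 1 / 15).\<close>

lemma spectral_sum_le:
  assumes E: "eigenbasis (lap pairs) d u l" and rs: "0 \<le> r" "0 \<le> s"
    and t: "real (card pairs) * (r + s) \<le> 2 * real t"
  shows "(\<Sum>i<d. (1 - l i / real (card pairs)) ^ (2 * t)) - 1
    \<le> exp (- s * ((real n - 2) / 6)) * (\<Sum>i<d. exp (- r * l i)) + real d * exp (- (2 * real t / 15))"
proof -
  let ?N = "real (card pairs)" and ?k = "(real n - 2) / 6"
  let ?a = "\<lambda>i. 1 - l i / ?N"
  have N: "?N > 0" using n3 by (simp add: card_pairs)
  have k: "?k > 0" using n3 by simp
  let ?b = "\<lambda>i. exp (- s * ?k) * exp (- r * l i) + exp (- (2 * real t / 15))"
  have bound: "?a i ^ (2 * t) \<le> ?b i" if i: "i < d" "l i \<noteq> 0" for i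
  proof -
    have lo: "?k \<le> l i" and hi: "l i \<le> (2 - 1 / 15) * ?N" using eigenvalue_bounds [OF E i(1)] i(2) by auto
    then have l0: "0 \<le> l i" using k by linarith
    show ?thesis
    proof (cases "l i \<le> ?N")
      case True
      have "?a i ^ (2 * t) \<le> exp (- (l i / ?N)) ^ (2 * t)"
        using True N exp_ge_add_one_self [of "- (l i / ?N)"] by (intro power_mono) auto
      also have "\<dots> = exp (- (2 * real t / ?N * l i))"
        by (simp add: exp_of_nat_mult [symmetric])
      also have "\<dots> \<le> exp (- ((r + s) * l i))"
      proof -
        have "r + s \<le> 2 * real t / ?N" using t N by (simp add: pos_le_divide_eq mult.commute)
        then have "(r + s) * l i \<le> 2 * real t / ?N * l i" using l0 by (rule mult_right_mono)
        then show ?thesis by simp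
      qed
      also have "\<dots> \<le> exp (- (r * l i) - s * ?k)"
        using mult_left_mono [OF lo rs(2)] by (simp add: distrib_right)
      also have "\<dots> = exp (- s * ?k) * exp (- r * l i)"
        by (simp add: exp_add [symmetric])
      finally show ?thesis using exp_gt_zero [of "- (2 * real t / 15)"] by linarith
    next
      case False
      have "\<bar>?a i\<bar> \<le> 1 - 1 / 15"
        using False hi N by (simp add: abs_if field_simps)
      also have "\<dots> \<le> exp (- (1 / 15))"
        using exp_ge_add_one_self [of "- (1 / 15)"] by simp
      finally have "\<bar>?a i\<bar> ^ (2 * t) \<le> exp (- (1 / 15)) ^ (2 * t)"
        by (intro power_mono) auto
      also have "\<dots> = exp (- (2 * real t / 15))"
        by (simp add: exp_of_nat_mult [symmetric])
      finally have "?a i ^ (2 * t) \<le> exp (- (2 * real t / 15))"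
        by (simp add: power_even_abs)
      then show ?thesis by (simp add: add_increasing)
    qed
  qed
  let ?Z = "{i \<in> {..<d}. l i = 0}"
  have "card ?Z \<le> 1"
    unfolding One_nat_def
    by (subst card_le_Suc0_iff_eq) (auto intro: eigenvalue_zero_unique [OF E])
  have "(\<Sum>i<d. ?a i ^ (2 * t)) = (\<Sum>i\<in>?Z. ?a i ^ (2 * t)) + (\<Sum>i\<in>{..<d} - ?Z. ?a i ^ (2 * t))"
    by (subst sum.subset_diff [of ?Z]) auto
  also have "(\<Sum>i\<in>?Z. ?a i ^ (2 * t)) = real (card ?Z)"
    by simp
  also have "(\<Sum>i\<in>{..<d} - ?Z. ?a i ^ (2 * t)) \<le> (\<Sum>i\<in>{..<d} - ?Z. ?b i)"
    by (intro sum_mono bound) auto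
  also have "\<dots> \<le> (\<Sum>i<d. ?b i)"
    by (intro sum_mono2) (auto intro: add_nonneg_nonneg)
  also have "\<dots> = exp (- s * ?k) * (\<Sum>i<d. exp (- r * l i)) + real d * exp (- (2 * real t / 15))"
    by (simp add: sum.distrib sum_distrib_left)
  finally show ?thesis using \<open>card ?Z \<le> 1\<close> by simp
qed

text \<open>At this time exp (- 2 r) is 1 / n. As n^2 = n + N, the factor 2 ^ N in the group order
  cancels the halves, leaving 2 ^ n (1 + 1 / n) ^ N, and N / n < n.\<close>

lemma heat_trace_le:
  assumes E: "eigenbasis (lap pairs) d u l"
  shows "(\<Sum>i<d. exp (- (ln (real n) / 2) * l i)) \<le> exp (2 * real n)"
proof -
  let ?N = "card pairs"
  have n: "real n > 0" using n3 by simp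
  have N: "n * n = n + ?N"
  proof -
    have "real (n * n) = real (n + ?N)" by (simp add: card_pairs algebra_simps)
    then show ?thesis by (simp only: of_nat_eq_iff)
  qed
  have e: "exp (- 2 * (ln (real n) / 2)) = 1 / real n"
    using n by (simp add: exp_minus inverse_eq_divide)
  have "(\<Sum>i<d. exp (- (ln (real n) / 2) * l i)) \<le> real (card (SL n)) * ((1 + 1 / real n) / 2) ^ ?N"
    using heat_trace [OF E, of "ln (real n) / 2"] unfolding e .
  also have "\<dots> \<le> 2 ^ (n * n) * ((1 + 1 / real n) / 2) ^ ?N"
  proof (rule mult_right_mono)
    have "real (card (SL n)) \<le> real (2 ^ (n * n))" using card_SL_le by (simp only: of_nat_le_iff)
    then show "real (card (SL n)) \<le> 2 ^ (n * n)" by simp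
  qed (simp add: add_nonneg_nonneg)
  also have "\<dots> = 2 ^ n * (1 + 1 / real n) ^ ?N"
    unfolding N by (simp add: power_add power_divide)
  also have "\<dots> \<le> exp 1 ^ n * exp (1 / real n) ^ ?N"
  proof (intro mult_mono power_mono)
    show "2 \<le> exp (1::real)" using exp_ge_add_one_self [of 1] by simp
    show "1 + 1 / real n \<le> exp (1 / real n)" by (rule exp_ge_add_one_self)
  qed (auto simp: add_nonneg_nonneg)
  also have "\<dots> = exp (real n + real ?N / real n)"
    by (simp add: exp_of_nat_mult [symmetric] exp_add [symmetric])
  also have "\<dots> \<le> exp (2 * real n)"
    using n by (simp add: card_pairs)
  finally show ?thesis .
qed

text \<open>The time is split into a part that brings the heat trace down to exp (2 n) and a part
  that uses the gap. The -2 in the hypothesis leaves room for rounding the time down.\<close>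

lemma l2_dist_le:
  assumes eps: "0 < \<epsilon>" "\<epsilon> < 1"
    and t: "200 * (real n)\<^sup>2 * ln (real n) + 200 * real n * ln (1 / \<epsilon>) - 2 \<le> 2 * real t"
  shows "l2_dist (SL n) (transvection_walk n) (uniform (SL n)) t \<le> \<epsilon>"
proof -
  define N where "N = real (card pairs)"
  define \<Lambda> where "\<Lambda> = ln (1 / \<epsilon>)"
  define r where "r = ln (real n) / 2"
  \<comment> \<open>Chosen so that s n / 18 = 2 n + 1 + 2 \<Lambda>, where n / 18 \<le> (n - 2) / 6
    for n \<ge> 3. This outweighs the heat trace exp (2 n) and leaves exp (- 1 - 2
    \<Lambda>).\<close>
  define s where "s = 36 + 18 / real n * (1 + 2 * \<Lambda>)"
  have n: "3 \<le> real n" using n3 by simp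
  have L: "0 \<le> \<Lambda>" using eps by (simp add: \<Lambda>_def)
  have ln1: "1 \<le> ln (real n)"
    using n exp_le by (subst ln_ge_iff) auto
  have eps2: "exp (- 1 - 2 * \<Lambda>) \<le> \<epsilon>\<^sup>2 / 2"
  proof -
    have "exp (- 1 - 2 * \<Lambda>) = exp (- 1) * (exp (- \<Lambda>))\<^sup>2"
      by (simp add: exp_of_nat_mult [symmetric] exp_add [symmetric] power2_eq_square)
    also have "exp (- \<Lambda>) = \<epsilon>" using eps by (simp add: \<Lambda>_def ln_div)
    also have "exp (- 1) \<le> (1 / 2 :: real)"
      using exp_ge_add_one_self [of 1] by (simp add: exp_minus field_simps)
    finally show ?thesis by (simp add: mult_right_mono)
  qed
  have sq: "(real n)\<^sup>2 \<ge> 3 * real n" "(real n)\<^sup>2 \<ge> 9"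
    using n mult_mono [of 3 "real n" 3 "real n"] by (simp_all add: power2_eq_square)
  have q: "(real n)\<^sup>2 \<le> (real n)\<^sup>2 * ln (real n)"
    using mult_left_mono [OF ln1, of "(real n)\<^sup>2"] by simp
  have nL: "3 * \<Lambda> \<le> real n * \<Lambda>" using n L by (intro mult_right_mono)
  have N: "0 \<le> N" "N \<le> (real n)\<^sup>2"
    using n by (simp_all add: N_def card_pairs power2_eq_square)
  have rs: "0 \<le> r" "0 \<le> s" using ln1 n L by (simp_all add: r_def s_def)
  have t': "200 * ((real n)\<^sup>2 * ln (real n)) + 200 * (real n * \<Lambda>) - 2 \<le> 2 * real t"
    using t by (simp add: \<Lambda>_def mult.assoc)
  have t1: "N * (r + s) \<le> 2 * real t"
  proof -
    have "N * (r + s) \<le> (real n)\<^sup>2 * (r + s)"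
      using N rs by (intro mult_right_mono) auto
    also have "\<dots> = (real n)\<^sup>2 * ln (real n) / 2 + 36 * (real n)\<^sup>2 + 18 * real n + 36 * (real n * \<Lambda>)"
      using n by (simp add: r_def s_def power2_eq_square field_simps)
    also have "\<dots> \<le> 200 * ((real n)\<^sup>2 * ln (real n)) + 200 * (real n * \<Lambda>) - 2"
      using sq q nL L by linarith
    also note t'
    finally show ?thesis .
  qed
  \<comment> \<open>For the eigenvalues above N, whose number is at most the group order and so at
    most exp (n^2).\<close>
  have t2: "(real n)\<^sup>2 + 1 + 2 * \<Lambda> \<le> 2 * real t / 15"
  proof -
    have "15 * (real n)\<^sup>2 + 15 + 30 * \<Lambda> \<le> 200 * ((real n)\<^sup>2 * ln (real n)) + 200 * (real n * \<Lambda>) - 2"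
      using sq q nL L by linarith
    then show ?thesis using t' by simp
  qed
  have "tp (lap pairs) = lap pairs" by (simp add: tp_lap)
  then obtain d u l where E: "eigenbasis (lap pairs) d u l"
    using spectral_theorem [of "lap pairs"] unfolding tp_eq_iff by blast
  have "exp (- s * ((real n - 2) / 6)) * (\<Sum>i<d. exp (- r * l i)) \<le> \<epsilon>\<^sup>2 / 2"
  proof -
    have "2 * real n + 1 + 2 * \<Lambda> = s * (real n / 18)"
      using n by (simp add: s_def field_simps)
    also have "\<dots> \<le> s * ((real n - 2) / 6)"
      using n rs by (intro mult_left_mono) auto
    finally have "exp (- s * ((real n - 2) / 6)) * (\<Sum>i<d. exp (- r * l i))
      \<le> exp (- (2 * real n + 1 + 2 * \<Lambda>)) * exp (2 * real n)"
      unfolding r_def by (intro mult_mono heat_trace_le [OF E]) (auto intro: sum_nonneg)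
    also have "\<dots> = exp (- 1 - 2 * \<Lambda>)" by (simp add: exp_add [symmetric])
    also note eps2
    finally show ?thesis .
  qed
  moreover have "real d * exp (- (2 * real t / 15)) \<le> \<epsilon>\<^sup>2 / 2"
  proof -
    have "d \<le> card (SL n)"
      using E unfolding eigenbasis_def by (blast intro: eigenfamily_card)
    then have "real d \<le> real (card (SL n))" by simp
    also have "\<dots> \<le> real (2 ^ (n * n))" using card_SL_le by (simp only: of_nat_le_iff)
    also have "\<dots> \<le> exp 1 ^ (n * n)"
      using exp_ge_add_one_self [of 1] by (simp add: power_mono)
    also have "\<dots> = exp ((real n)\<^sup>2)"
      by (simp add: exp_of_nat_mult [symmetric] power2_eq_square)
    finally have "real d * exp (- (2 * real t / 15)) \<le> exp ((real n)\<^sup>2) * exp (- ((real n)\<^sup>2 + 1 + 2 * \<Lambda>))"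
      using t2 by (intro mult_mono) auto
    also have "\<dots> = exp (- 1 - 2 * \<Lambda>)" by (simp add: exp_add [symmetric])
    also note eps2
    finally show ?thesis .
  qed
  ultimately have sum: "(\<Sum>i<d. (1 - l i / real (card pairs)) ^ (2 * t)) - 1 \<le> \<epsilon>\<^sup>2"
    using spectral_sum_le [OF E rs t1 [unfolded N_def]] by linarith
  have "l2_norm (SL n) (uniform (SL n)) (\<lambda>y. walk_step t x y / uniform (SL n) y - 1) \<le> \<epsilon>"
    if x: "x \<in> SL n" for x
  proof (rule power2_le_imp_le)
    show "(l2_norm (SL n) (uniform (SL n)) (\<lambda>y. walk_step t x y / uniform (SL n) y - 1))\<^sup>2 \<le> \<epsilon>\<^sup>2"
      unfolding l2_norm_walk_step [OF E x] by (rule sum)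
  qed (use eps in simp)
  then show ?thesis
    unfolding l2_dist_def using SL_one [of n] by (subst Max_le_iff) auto
qed

end

theorem theorem1:
  shows "\<exists>A B :: real. A > 0 \<and> B > 0 \<and>
    (\<forall>(n::nat) (\<epsilon>::real). n \<ge> 3 \<longrightarrow> 0 < \<epsilon> \<longrightarrow> \<epsilon> < 1 \<longrightarrow>
      ereal_of_enat (l2_mixing_time (SL n) (transvection_walk n) (uniform (SL n)) \<epsilon>)
        \<le> ereal (A * (real n)\<^sup>2 * ln (real n) + B * real n * ln (1 / \<epsilon>)))"
proof (intro exI conjI allI impI)
  fix n :: nat and \<epsilon> :: real
  assume n: "n \<ge> 3" and eps: "0 < \<epsilon>" "\<epsilon> < 1"
  interpret transvections n by standard (rule n)
  \<comment> \<open>Both constants are 100. Rounding down loses less than 1, which doubled is the 2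
    allowed for in \<open>l2_dist_le\<close>.\<close>
  let ?X = "100 * (real n)\<^sup>2 * ln (real n) + 100 * real n * ln (1 / \<epsilon>)"
  define t where "t = nat \<lfloor>?X\<rfloor>"
  have "0 \<le> ?X" using n eps by (intro add_nonneg_nonneg mult_nonneg_nonneg) auto
  then have t: "real t \<le> ?X" "?X - 1 \<le> real t"
    unfolding t_def by linarith+
  have "l2_dist (SL n) (transvection_walk n) (uniform (SL n)) t \<le> \<epsilon>"
    using t(2) by (intro l2_dist_le eps) simp
  then have "l2_mixing_time (SL n) (transvection_walk n) (uniform (SL n)) \<epsilon> \<le> enat t"
    unfolding l2_mixing_time_def by (intro INF_lower) simp
  then have "ereal_of_enat (l2_mixing_time (SL n) (transvection_walk n) (uniform (SL n)) \<epsilon>)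
      \<le> ereal_of_enat (enat t)"
    by (simp only: ereal_of_enat_le_iff)
  also have "\<dots> \<le> ereal ?X" using t(1) by simp
  finally show "ereal_of_enat (l2_mixing_time (SL n) (transvection_walk n) (uniform (SL n)) \<epsilon>)
      \<le> ereal ?X" .
qed simp_all

end
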